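(* Let $\mathfrak X$ be a Polish space, $(\Theta,\prec)$ a directed set, $(L_\theta)_{\theta\in\Theta}$ a net of random probability measures with values in $\mathcal P(\mathfrak X)$, and $r_\theta\in(0,\infty)$ with $\lim_{\theta\in\Theta}r_\theta=\infty$. Suppose that hypothesis $\mathbf{(AET)}$ is satisfied: for any $l>0$ there exists a compact set $\mathcal K_l\subset\mathcal P(\mathfrak X)$ such that for every $r>0$, $$\limsup_{\theta\in\Theta}\frac1{r_\theta}\log\mathbb P\big(L_\theta\in B_{\mathcal P(\mathfrak X)}(\mathcal K_l,r)^C\big)\le-l.$$ Then the function $I$ defined in the context is a good rate function, and for any closed set $F\subset\mathcal P(\mathfrak X)$ and open set $G\subset\mathcal P(\mathfrak X)$, $$\limsup_{\theta\in\Theta}\frac1{r_\theta}\log\mathbb P(L_\theta\in F)\le-\inf\{I(\sigma):\sigma\in F\},$$ $$\liminf_{\theta\in\Theta}\frac1{r_\theta}\log\mathbb P(L_\theta\in G)\ge-\inf\{I(\sigma):\sigma\in G\cap\mathcal W\}.$$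
   Context: $\mathcal P(\mathfrak X)$ is the space of Borel probability measures with the weak topology, metrized by the dual-Lipschitz distance $\|\mu-\nu\|_L^*=\sup\{|\langle f,\mu\rangle-\langle f,\nu\rangle|:\|f\|_\infty+\operatorname{Lip}(f)\le1\}$, where $\langle f,\mu\rangle=\int f\,d\mu$; $B_{\mathcal P(\mathfrak X)}(\mathcal K,r)$ is the open $r$-neighbourhood of $\mathcal K$ in this distance and $^C$ denotes complement. $C_b(\mathfrak X)$ and $L_b(\mathfrak X)$ are the bounded continuous and bounded Lipschitz real functions. Pressure function: $\Lambda(V)=\limsup_{\theta\in\Theta}\frac1{r_\theta}\log\mathbb E e^{r_\theta\langle V,L_\theta\rangle}$ for $V\in C_b(\mathfrak X)$. Its Legendre transform: $I(\sigma)=\sup_{V\in C_b(\mathfrak X)}(\langle V,\sigma\rangle-\Lambda(V))$ for $\sigma\in\mathcal P(\mathfrak X)$, with values in $[0,\infty]$. An equilibrium state for $V$ is a measure $\sigma\in\mathcal P(\mathfrak X)$ with $\Lambda(V)=\langle V,\sigma\rangle-I(\sigma)$. $\mathcal V$ is the set of $V\in L_b(\mathfrak X)$ such that (1) the $\limsup$ defining $\Lambda(V)$ is a limit, and (2) $V$ has a unique equilibrium state, denoted $\sigma_V$. $\mathcal W=\{\sigma_V:V\in\mathcal V\}$. A rate function is a lower semicontinuous $[0,\infty]$-valued function; it is good if all sublevel sets $\{I\le a\}$, $a<\infty$, are compact. Conventions: $\log0=-\infty$, $\inf\emptyset=\infty$. *)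

theory Defs
  imports "HOL-Probability.Probability"
begin

section \<open>Nets\<close>

definition directed_set :: "'i set \<Rightarrow> ('i \<Rightarrow> 'i \<Rightarrow> bool) \<Rightarrow> bool" where
  "directed_set \<Theta> prec \<longleftrightarrow>
     \<Theta> \<noteq> {} \<and> reflp_on \<Theta> prec \<and> transp_on \<Theta> prec \<and>
     (\<forall>a\<in>\<Theta>. \<forall>b\<in>\<Theta>. \<exists>c\<in>\<Theta>. prec a c \<and> prec b c)"

text \<open>The section filter of a directed set: \<open>Limsup (net_filter \<Theta> prec) f\<close> is the
  infimum over \<open>\<theta>0 \<in> \<Theta>\<close> of the supremum of \<open>f\<close> over the \<open>\<theta> \<in> \<Theta>\<close> that follow \<open>\<theta>0\<close>.\<close>

definition net_filter :: "'i set \<Rightarrow> ('i \<Rightarrow> 'i \<Rightarrow> bool) \<Rightarrow> 'i filter" where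
  "net_filter \<Theta> prec = (INF \<theta>0\<in>\<Theta>. principal {\<theta> \<in> \<Theta>. prec \<theta>0 \<theta>})"

text \<open>Logarithm with the convention that the logarithm of 0 is \<open>-\<infinity>\<close>
  (it is only applied to nonnegative numbers).\<close>

definition elog :: "real \<Rightarrow> ereal" where
  "elog x = (if x \<le> 0 then -\<infinity> else ereal (ln x))"

section \<open>The space of Borel probability measures\<close>

definition prob_measures :: "'a::polish_space measure set" where
  "prob_measures = {\<mu>. prob_space \<mu> \<and> sets \<mu> = sets borel}"

definition bounded_lipschitz :: "('a::metric_space \<Rightarrow> real) set" where
  "bounded_lipschitz = {f \<in> bcontfun. \<exists>C. C-lipschitz_on UNIV f}"

text \<open>The coarsest topology on the probability measures that makes integration against every
  bounded continuous function continuous.\<close>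

definition weak_topology :: "'a::polish_space measure topology" where
  "weak_topology = topology_generated_by
     {{\<mu> \<in> prob_measures. (\<integral>x. V x \<partial>\<mu>) \<in> U} | (V :: 'a \<Rightarrow> real) U. V \<in> bcontfun \<and> open U}"

lemma topspace_weak_topology [simp]:
  "topspace (weak_topology :: 'a::polish_space measure topology) = prob_measures"
proof -
  have "(prob_measures :: 'a measure set) \<in>
        {{\<mu> \<in> prob_measures. (\<integral>x. V x \<partial>\<mu>) \<in> U} | (V :: 'a \<Rightarrow> real) U. V \<in> bcontfun \<and> open U}"
    by (auto intro!: exI[of _ "\<lambda>_. 0"] exI[of _ UNIV] const_bcontfun)
  then show ?thesis
    unfolding weak_topology_def by (simp only: topology_generated_by_topspace) blast
qed

definition weak_borel :: "'a::polish_space measure measure" where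
  "weak_borel = sigma prob_measures {U. openin weak_topology U}"

text \<open>The two suprema are real-valued and meant for bounded Lipschitz functions only. The pairs
  \<open>x = y\<close> contribute \<open>0 / 0 = 0\<close> to the second one.\<close>

definition sup_norm :: "('a \<Rightarrow> real) \<Rightarrow> real" where
  "sup_norm f = (SUP x. \<bar>f x\<bar>)"

definition lip_const :: "('a::metric_space \<Rightarrow> real) \<Rightarrow> real" where
  "lip_const f = (SUP (x, y). \<bar>f x - f y\<bar> / dist x y)"

definition dual_lipschitz_dist :: "'a::polish_space measure \<Rightarrow> 'a measure \<Rightarrow> real" where
  "dual_lipschitz_dist \<mu> \<nu> =
     (SUP f\<in>{f \<in> bounded_lipschitz. sup_norm f + lip_const f \<le> 1}.
        \<bar>(\<integral>x. f x \<partial>\<mu>) - (\<integral>x. f x \<partial>\<nu>)\<bar>)"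

definition prob_nhd :: "'a::polish_space measure set \<Rightarrow> real \<Rightarrow> 'a measure set" where
  "prob_nhd K \<epsilon> = {\<mu> \<in> prob_measures. \<exists>\<nu>\<in>K. dual_lipschitz_dist \<mu> \<nu> < \<epsilon>}"

section \<open>Rate functions\<close>

text \<open>Lower semicontinuity is expressed through closedness of the sublevel sets.\<close>

definition rate_function :: "'b topology \<Rightarrow> ('b \<Rightarrow> ereal) \<Rightarrow> bool" where
  "rate_function T I \<longleftrightarrow>
     (\<forall>x\<in>topspace T. 0 \<le> I x) \<and> (\<forall>a::real. closedin T {x \<in> topspace T. I x \<le> ereal a})"

definition good_rate_function :: "'b topology \<Rightarrow> ('b \<Rightarrow> ereal) \<Rightarrow> bool" where
  "good_rate_function T I \<longleftrightarrow>
     rate_function T I \<and> (\<forall>a::real. compactin T {x \<in> topspace T. I x \<le> ereal a})"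

section \<open>Pressure, its Legendre transform, and equilibrium states\<close>

text \<open>Below, \<open>N\<close> is the filter of the net, \<open>M\<close> the underlying probability space, \<open>L\<close> the net of
  random measures and \<open>r\<close> the net of speeds.\<close>

definition scaled_log_mgf ::
  "'w measure \<Rightarrow> ('i \<Rightarrow> 'w \<Rightarrow> 'a::polish_space measure) \<Rightarrow> ('i \<Rightarrow> real) \<Rightarrow>
   ('a \<Rightarrow> real) \<Rightarrow> 'i \<Rightarrow> ereal" where
  "scaled_log_mgf M L r V \<theta> =
     ereal (1 / r \<theta>) * elog (\<integral>\<omega>. exp (r \<theta> * (\<integral>x. V x \<partial>(L \<theta> \<omega>))) \<partial>M)"

definition pressure ::
  "'i filter \<Rightarrow> 'w measure \<Rightarrow> ('i \<Rightarrow> 'w \<Rightarrow> 'a::polish_space measure) \<Rightarrow> ('i \<Rightarrow> real) \<Rightarrow>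
   ('a \<Rightarrow> real) \<Rightarrow> ereal" where
  "pressure N M L r V = Limsup N (scaled_log_mgf M L r V)"

definition legendre_rate ::
  "'i filter \<Rightarrow> 'w measure \<Rightarrow> ('i \<Rightarrow> 'w \<Rightarrow> 'a::polish_space measure) \<Rightarrow> ('i \<Rightarrow> real) \<Rightarrow>
   'a measure \<Rightarrow> ereal" where
  "legendre_rate N M L r \<sigma> =
     (SUP V\<in>bcontfun. ereal (\<integral>x. V x \<partial>\<sigma>) - pressure N M L r V)"

definition equilibrium_state ::
  "'i filter \<Rightarrow> 'w measure \<Rightarrow> ('i \<Rightarrow> 'w \<Rightarrow> 'a::polish_space measure) \<Rightarrow> ('i \<Rightarrow> real) \<Rightarrow>
   ('a \<Rightarrow> real) \<Rightarrow> 'a measure \<Rightarrow> bool" where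
  "equilibrium_state N M L r V \<sigma> \<longleftrightarrow>
     \<sigma> \<in> prob_measures \<and>
     pressure N M L r V = ereal (\<integral>x. V x \<partial>\<sigma>) - legendre_rate N M L r \<sigma>"

definition admissible_potentials ::
  "'i filter \<Rightarrow> 'w measure \<Rightarrow> ('i \<Rightarrow> 'w \<Rightarrow> 'a::polish_space measure) \<Rightarrow> ('i \<Rightarrow> real) \<Rightarrow>
   ('a \<Rightarrow> real) set" where
  "admissible_potentials N M L r =
     {V \<in> bounded_lipschitz.
        (scaled_log_mgf M L r V \<longlongrightarrow> pressure N M L r V) N \<and>
        (\<exists>!\<sigma>. equilibrium_state N M L r V \<sigma>)}"

definition unique_equilibrium_states ::
  "'i filter \<Rightarrow> 'w measure \<Rightarrow> ('i \<Rightarrow> 'w \<Rightarrow> 'a::polish_space measure) \<Rightarrow> ('i \<Rightarrow> real) \<Rightarrow>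
   'a measure set" where
  "unique_equilibrium_states N M L r =
     (\<lambda>V. THE \<sigma>. equilibrium_state N M L r V \<sigma>) ` admissible_potentials N M L r"

end

theory Submission
  imports Defs
begin

text \<open>
  The dual Lipschitz distance metrizes the weak topology, so a weakly open set that contains a compact
  set \<open>K\<close> contains a neighbourhood of \<open>K\<close>, which \<open>AET\<close> controls. A point \<open>\<sigma>\<close> with
  \<open>I \<sigma> > \<langle>V, \<sigma>\<rangle> - c\<close> is witnessed by a potential \<open>W\<close>, and on a half space around \<open>\<sigma>\<close> the exponential
  Chebyshev inequality compares the integral of \<open>exp (r \<langle>V, L\<rangle>)\<close> with that of \<open>exp (r \<langle>W, L\<rangle>)\<close>. Covering the
  compact part of a closed set \<open>F\<close> by such half spaces bounds the exponential growth rate of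
  the integral of \<open>exp (r \<langle>V, L\<rangle>)\<close> over \<open>{L \<in> F}\<close> strictly below \<open>c\<close>. For \<open>V = 0\<close> this is the upper bound. For an
  admissible \<open>V\<close> and \<open>c = \<Lambda> V\<close>, uniqueness of the equilibrium state \<open>\<sigma>\<close> gives the hypothesis off any
  neighbourhood of \<open>\<sigma>\<close>, so the whole growth of the integral comes from that neighbourhood, which
  is the lower bound.

  For goodness of \<open>I\<close>, testing against \<open>V = l (1 - h)\<close> with \<open>h\<close> close to a cutoff of finitely many
  small balls shows that sublevel sets of \<open>I\<close> are uniformly tight. Tightness yields compactness as in
  Prokhorov's theorem: points are coded by words over the naturals, cylinder probabilities
  converge along a subsequence, and decoding a random word with the limiting
  probabilities gives the limit measure.
\<close>

section \<open>The dual Lipschitz metric\<close>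

lemma prob_measuresD:
  assumes "\<mu> \<in> prob_measures"
  shows "prob_space \<mu>" "sets \<mu> = sets borel" "space \<mu> = UNIV"
  using assms sets_eq_imp_space_eq[of \<mu> borel] by (auto simp: prob_measures_def)

lemma bcontfunI:
  fixes f :: "'a::topological_space \<Rightarrow> real"
  assumes "continuous_on UNIV f" "\<And>x. \<bar>f x\<bar> \<le> B"
  shows "f \<in> bcontfun"
  using assms by (auto simp: bcontfun_def bounded_iff)

lemma bcontfun_boundE:
  fixes f :: "'a::topological_space \<Rightarrow> real"
  assumes "f \<in> bcontfun"
  obtains B where "0 \<le> B" "\<And>x. \<bar>f x\<bar> \<le> B"
proof -
  from assms obtain B where "\<forall>x. \<bar>f x\<bar> \<le> B" by (auto simp: bcontfun_def bounded_iff)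
  then show ?thesis using that[of "max B 0"] by (auto simp: le_max_iff_disj)
qed

lemma bcontfun_continuous: "f \<in> bcontfun \<Longrightarrow> continuous_on UNIV f"
  by (simp add: bcontfun_def)

lemma bcontfun_measurable:
  fixes f :: "'a::topological_space \<Rightarrow> real"
  shows "f \<in> bcontfun \<Longrightarrow> f \<in> borel_measurable borel"
  by (rule borel_measurable_continuous_onI) (rule bcontfun_continuous)

lemma bcontfun_measurable_prob:
  fixes f :: "'a::polish_space \<Rightarrow> real"
  shows "\<mu> \<in> prob_measures \<Longrightarrow> f \<in> bcontfun \<Longrightarrow> f \<in> borel_measurable \<mu>"
  using bcontfun_measurable[of f] measurable_cong_sets[of \<mu> borel borel borel] prob_measuresD(2)[of \<mu>]
  by auto

lemma integrable_bcontfun: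
  fixes f :: "'a::polish_space \<Rightarrow> real"
  assumes "\<mu> \<in> prob_measures" "f \<in> bcontfun"
  shows "integrable \<mu> f"
proof -
  interpret prob_space \<mu> using prob_measuresD[OF assms(1)] by simp
  obtain B where "\<And>x. \<bar>f x\<bar> \<le> B" using bcontfun_boundE[OF assms(2)] by blast
  then show ?thesis
    using bcontfun_measurable_prob[OF assms] by (intro integrable_const_bound[of _ B]) auto
qed

lemma abs_integral_le:
  fixes f :: "'a::polish_space \<Rightarrow> real"
  assumes "\<mu> \<in> prob_measures" "\<And>x. \<bar>f x\<bar> \<le> B" "f \<in> bcontfun"
  shows "\<bar>\<integral>x. f x \<partial>\<mu>\<bar> \<le> B"
proof -
  interpret prob_space \<mu> using prob_measuresD[OF assms(1)] by simp
  have i: "integrable \<mu> f" by (rule integrable_bcontfun[OF assms(1,3)])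
  have "-B \<le> f x" "f x \<le> B" for x using assms(2)[of x] by linarith+
  then have "(\<integral>x. f x \<partial>\<mu>) \<le> B" "-B \<le> (\<integral>x. f x \<partial>\<mu>)"
    by (intro integral_le_const integral_ge_const i AE_I2; blast)+
  then show ?thesis by linarith
qed

section \<open>Bounded Lipschitz functions and the distance they define\<close>

lemma bounded_lipschitz_bcontfun: "f \<in> bounded_lipschitz \<Longrightarrow> f \<in> bcontfun"
  by (simp add: bounded_lipschitz_def)

lemma bounded_lipschitzI:
  fixes f :: "'a::metric_space \<Rightarrow> real"
  assumes "\<And>x. \<bar>f x\<bar> \<le> B" "C-lipschitz_on UNIV f"
  shows "f \<in> bounded_lipschitz"
  using assms lipschitz_on_continuous_on[OF assms(2)] bcontfunI[of f B]
  by (auto simp: bounded_lipschitz_def)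

lemma sup_norm_upper:
  assumes "f \<in> bcontfun"
  shows "\<bar>f x\<bar> \<le> sup_norm f"
proof -
  obtain B where "\<And>x. \<bar>f x\<bar> \<le> B" using bcontfun_boundE[OF assms] by blast
  then show ?thesis unfolding sup_norm_def by (intro cSUP_upper bdd_aboveI2[of _ _ B]) auto
qed

lemma lip_const_ge_quotient:
  fixes f :: "'a::metric_space \<Rightarrow> real"
  assumes "f \<in> bounded_lipschitz"
  shows "\<bar>f x - f y\<bar> / dist x y \<le> lip_const f"
proof -
  obtain C where C: "C-lipschitz_on UNIV f" using assms by (auto simp: bounded_lipschitz_def)
  have "\<bar>f a - f b\<bar> / dist a b \<le> C" for a b
  proof -
    have "\<bar>f a - f b\<bar> \<le> C * dist a b" using lipschitz_onD[OF C, of a b] by (simp add: dist_real_def)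
    moreover have "0 \<le> C" using lipschitz_on_nonneg[OF C] .
    ultimately show ?thesis by (cases "a = b") (auto simp: pos_divide_le_eq)
  qed
  then have "bdd_above (range (\<lambda>(x, y). \<bar>f x - f y\<bar> / dist x y))"
    by (intro bdd_aboveI2[of _ _ C]) auto
  then have "(\<lambda>(x, y). \<bar>f x - f y\<bar> / dist x y) (x, y) \<le> lip_const f"
    unfolding lip_const_def by (intro cSUP_upper) auto
  then show ?thesis by simp
qed

lemma lip_const_upper:
  fixes f :: "'a::metric_space \<Rightarrow> real"
  assumes "f \<in> bounded_lipschitz"
  shows "\<bar>f x - f y\<bar> \<le> lip_const f * dist x y"
  using lip_const_ge_quotient[OF assms, of x y] by (cases "x = y") (auto simp: pos_divide_le_eq)

text \<open>A diagonal pair contributes \<open>0 / 0 = 0\<close> to the supremum, so this holds even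
  on a one-point space.\<close>

lemma lip_const_nonneg:
  fixes f :: "'a::metric_space \<Rightarrow> real"
  shows "f \<in> bounded_lipschitz \<Longrightarrow> 0 \<le> lip_const f"
  using lip_const_ge_quotient[of f undefined undefined] by simp

lemma lipschitz_unit_ball_bounds:
  fixes f :: "'a::metric_space \<Rightarrow> real"
  assumes "f \<in> bounded_lipschitz" "sup_norm f + lip_const f \<le> 1"
  shows "\<bar>f x\<bar> \<le> 1" "\<bar>f x - f y\<bar> \<le> dist x y"
proof -
  have s: "\<bar>f z\<bar> \<le> sup_norm f" for z
    using sup_norm_upper bounded_lipschitz_bcontfun assms(1) by blast
  then have "0 \<le> sup_norm f" using abs_ge_zero order_trans by blast
  then have l: "lip_const f \<le> 1" using assms by linarith
  show "\<bar>f x\<bar> \<le> 1" using s[of x] lip_const_nonneg[OF assms(1)] assms(2) by linarith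
  have "lip_const f * dist x y \<le> dist x y" using l mult_right_mono[of "lip_const f" 1 "dist x y"] by simp
  then show "\<bar>f x - f y\<bar> \<le> dist x y" using lip_const_upper[OF assms(1), of x y] by linarith
qed

text \<open>Estimates of a real supremum need a nonempty index set. The zero function supplies a
  member, and its contribution 0 makes the distance nonnegative.\<close>

lemma zero_in_lipschitz_unit_ball:
  "(\<lambda>_::'a::metric_space. 0::real) \<in> {f \<in> bounded_lipschitz. sup_norm f + lip_const f \<le> 1}"
  by (auto simp: sup_norm_def lip_const_def case_prod_unfold intro!: bounded_lipschitzI[of _ 0 0] lipschitz_onI)

lemma dual_lipschitz_dist_bdd:
  assumes "\<mu> \<in> prob_measures" "\<nu> \<in> prob_measures"
  shows "bdd_above ((\<lambda>f. \<bar>(\<integral>x. f x \<partial>\<mu>) - (\<integral>x. f x \<partial>\<nu>)\<bar>) `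
    {f \<in> bounded_lipschitz. sup_norm f + lip_const f \<le> 1})"
proof (rule bdd_aboveI2)
  fix f :: "'a \<Rightarrow> real" assume f: "f \<in> {f \<in> bounded_lipschitz. sup_norm f + lip_const f \<le> 1}"
  then have "\<bar>\<integral>x. f x \<partial>\<mu>\<bar> \<le> 1" "\<bar>\<integral>x. f x \<partial>\<nu>\<bar> \<le> 1"
    using lipschitz_unit_ball_bounds(1)[of f] bounded_lipschitz_bcontfun[of f] assms
    by (auto intro!: abs_integral_le)
  then show "\<bar>(\<integral>x. f x \<partial>\<mu>) - (\<integral>x. f x \<partial>\<nu>)\<bar> \<le> 2" by linarith
qed

text \<open>The pointwise conditions describe a class containing the unit ball of the definition, so
  upper estimates can be checked without computing the two suprema.\<close>

lemma dual_lipschitz_dist_leI: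
  assumes "\<And>f. f \<in> bcontfun \<Longrightarrow> (\<And>x. \<bar>f x\<bar> \<le> 1) \<Longrightarrow> (\<And>x y. \<bar>f x - f y\<bar> \<le> dist x y) \<Longrightarrow>
    \<bar>(\<integral>x. f x \<partial>\<mu>) - (\<integral>x. f x \<partial>\<nu>)\<bar> \<le> e"
  shows "dual_lipschitz_dist \<mu> \<nu> \<le> e"
  unfolding dual_lipschitz_dist_def
proof (intro cSUP_least, goal_cases)
  case 1
  then show ?case using zero_in_lipschitz_unit_ball by blast
next
  case (2 f)
  then have f: "f \<in> bounded_lipschitz" "sup_norm f + lip_const f \<le> 1" by auto
  show ?case
    by (intro assms bounded_lipschitz_bcontfun lipschitz_unit_ball_bounds f)
qed

lemma abs_integral_diff_le_dist:
  fixes f :: "'a::polish_space \<Rightarrow> real"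
  assumes "\<mu> \<in> prob_measures" "\<nu> \<in> prob_measures" "\<And>x. \<bar>f x\<bar> \<le> B" "C-lipschitz_on UNIV f"
  shows "\<bar>(\<integral>x. f x \<partial>\<mu>) - (\<integral>x. f x \<partial>\<nu>)\<bar> \<le> (B + C + 1) * dual_lipschitz_dist \<mu> \<nu>"
proof -
  have B: "0 \<le> B" using assms(3) abs_ge_zero order_trans by blast
  have C: "0 \<le> C" using lipschitz_on_nonneg[OF assms(4)] .
  \<comment> \<open>Dividing \<open>f\<close> by \<open>c\<close> puts it into the unit ball,
    because \<open>B / c + C / c \<le> 1\<close>; the summand 1 keeps \<open>c\<close> positive when
    both bounds vanish.\<close>
  define c where "c = B + C + 1"
  have c: "c > 0" using B C by (simp add: c_def)
  define g where "g x = f x / c" for x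
  have L: "\<bar>f x - f y\<bar> \<le> C * dist x y" for x y
    using lipschitz_onD[OF assms(4), of x y] by (simp add: dist_real_def)
  have g1: "\<bar>g x\<bar> \<le> B / c" for x using assms(3)[of x] c by (simp add: g_def divide_right_mono)
  have g2: "\<bar>g x - g y\<bar> \<le> C / c * dist x y" for x y
    using L[of x y] c by (simp add: g_def divide_right_mono flip: diff_divide_distrib)
  have gb: "g \<in> bounded_lipschitz"
    using B C c by (intro bounded_lipschitzI[of g "B/c" "C/c"] g1 lipschitz_onI) (use g2 in \<open>auto simp: dist_real_def\<close>)
  have "sup_norm g \<le> B / c" unfolding sup_norm_def by (intro cSUP_least) (auto simp: g1)
  moreover have "lip_const g \<le> C / c" unfolding lip_const_def
  proof (intro cSUP_least, goal_cases)
    case (2 p)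
    obtain x y where p: "p = (x, y)" by force
    show ?case using g2[of x y] C c by (cases "x = y") (auto simp: p pos_divide_le_eq)
  qed simp
  moreover have "B / c + C / c \<le> 1" using c by (simp add: c_def flip: add_divide_distrib)
  ultimately have "sup_norm g + lip_const g \<le> 1" by linarith
  then have "\<bar>(\<integral>x. g x \<partial>\<mu>) - (\<integral>x. g x \<partial>\<nu>)\<bar> \<le> dual_lipschitz_dist \<mu> \<nu>"
    unfolding dual_lipschitz_dist_def using gb
    by (intro cSUP_upper dual_lipschitz_dist_bdd assms) auto
  moreover have "(\<integral>x. g x \<partial>\<mu>) - (\<integral>x. g x \<partial>\<nu>) = ((\<integral>x. f x \<partial>\<mu>) - (\<integral>x. f x \<partial>\<nu>)) / c"
    by (simp add: g_def diff_divide_distrib)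
  ultimately show ?thesis using c by (simp add: c_def field_simps)
qed

lemma dual_lipschitz_dist_triangle:
  assumes "\<mu> \<in> prob_measures" "\<nu> \<in> prob_measures" "\<kappa> \<in> prob_measures"
  shows "dual_lipschitz_dist \<mu> \<kappa> \<le> dual_lipschitz_dist \<mu> \<nu> + dual_lipschitz_dist \<nu> \<kappa>"
  unfolding dual_lipschitz_dist_def[of \<mu> \<kappa>]
proof (intro cSUP_least, goal_cases)
  case 1
  then show ?case using zero_in_lipschitz_unit_ball by blast
next
  case (2 f)
  then have "\<bar>(\<integral>x. f x \<partial>\<mu>) - (\<integral>x. f x \<partial>\<nu>)\<bar> \<le> dual_lipschitz_dist \<mu> \<nu>"
    "\<bar>(\<integral>x. f x \<partial>\<nu>) - (\<integral>x. f x \<partial>\<kappa>)\<bar> \<le> dual_lipschitz_dist \<nu> \<kappa>"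
    unfolding dual_lipschitz_dist_def by (intro cSUP_upper dual_lipschitz_dist_bdd assms; simp)+
  then show ?case by linarith
qed

lemma dual_lipschitz_dist_nonneg:
  "0 \<le> dual_lipschitz_dist \<mu> \<nu>" if "\<mu> \<in> prob_measures" "\<nu> \<in> prob_measures"
  using cSUP_upper[OF zero_in_lipschitz_unit_ball dual_lipschitz_dist_bdd[OF that]]
  by (simp add: dual_lipschitz_dist_def)

text \<open>Inf-convolution with a large multiple of the metric approximates a bounded continuous function
  from below by Lipschitz functions; this makes integration lower semicontinuous for the metric.\<close>

definition inf_conv :: "real \<Rightarrow> ('a::metric_space \<Rightarrow> real) \<Rightarrow> 'a \<Rightarrow> real" where
  "inf_conv k V x = (INF y. V y + k * dist x y)"

context
  fixes V :: "'a::metric_space \<Rightarrow> real" and B k :: real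
  assumes V: "\<And>x. \<bar>V x\<bar> \<le> B" and k: "0 \<le> k"
begin

lemma inf_conv_bdd: "bdd_below (range (\<lambda>y. V y + k * dist x y))"
proof (rule bdd_belowI2)
  fix y
  have "0 \<le> k * dist x y" "-B \<le> V y" using V[of y] k by auto
  then show "-B \<le> V y + k * dist x y" by linarith
qed

lemma inf_conv_le: "inf_conv k V x \<le> V y + k * dist x y"
  unfolding inf_conv_def by (intro cINF_lower inf_conv_bdd) simp

lemma inf_conv_ge: "(\<And>y. a \<le> V y + k * dist x y) \<Longrightarrow> a \<le> inf_conv k V x"
  unfolding inf_conv_def by (intro cINF_greatest) auto

lemma inf_conv_le_self: "inf_conv k V x \<le> V x"
  using inf_conv_le[of x x] by simp

lemma inf_conv_bound: "\<bar>inf_conv k V x\<bar> \<le> B"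
proof -
  have "-B \<le> inf_conv k V x"
  proof (rule inf_conv_ge)
    fix y
    have "0 \<le> k * dist x y" "-B \<le> V y" using V[of y] k by auto
    then show "-B \<le> V y + k * dist x y" by linarith
  qed
  then show ?thesis using inf_conv_le_self[of x] V[of x] by linarith
qed

lemma inf_conv_lipschitz: "k-lipschitz_on UNIV (inf_conv k V)"
proof (rule lipschitz_onI[OF _ k])
  have *: "inf_conv k V x - k * dist x y \<le> inf_conv k V y" for x y
  proof (rule inf_conv_ge)
    fix z
    have "k * dist x z \<le> k * dist x y + k * dist y z"
      using mult_left_mono[OF dist_triangle[of x z y] k] by (simp add: distrib_left)
    then show "inf_conv k V x - k * dist x y \<le> V z + k * dist y z" using inf_conv_le[of x z] by linarith
  qed
  show "dist (inf_conv k V x) (inf_conv k V y) \<le> k * dist x y" for x y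
    using *[of x y] *[of y x] by (simp add: dist_real_def dist_commute abs_le_iff)
qed

end

lemma inf_conv_tendsto:
  fixes V :: "'a::metric_space \<Rightarrow> real"
  assumes "continuous_on UNIV V" and V: "\<And>x. \<bar>V x\<bar> \<le> B"
  shows "(\<lambda>k. inf_conv (real k) V x) \<longlonglongrightarrow> V x"
proof (rule LIMSEQ_I)
  fix e :: real assume e: "0 < e"
  have "isCont V x" using assms(1) by (simp add: continuous_on_eq_continuous_at)
  then obtain d where d: "d > 0" "\<And>y. dist y x < d \<Longrightarrow> dist (V y) (V x) < e / 2"
    using e unfolding continuous_at_eps_delta by (metis half_gt_zero)
  \<comment> \<open>Beyond distance \<open>d\<close> the penalty is at least \<open>2 * B\<close>,
    the largest possible oscillation of \<open>V\<close>; within distance \<open>d\<close>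
    continuity bounds the loss by \<open>e / 2\<close>.\<close>
  obtain K :: nat where K: "2 * B / d < real K" using reals_Archimedean2 by blast
  have "norm (inf_conv (real k) V x - V x) < e" if "k \<ge> K" for k
  proof -
    have kd: "2 * B \<le> real k * d" using K that d(1) by (simp add: pos_divide_less_eq) (smt (verit) mult_right_mono of_nat_mono)
    have "V x - e / 2 \<le> inf_conv (real k) V x"
    proof (rule inf_conv_ge)
      fix y
      show "V x - e / 2 \<le> V y + real k * dist x y"
      proof (cases "dist y x < d")
        case True
        have "0 \<le> real k * dist x y" by simp
        then show ?thesis using d(2)[OF True] unfolding dist_real_def by linarith
      next
        case False
        then have "real k * d \<le> real k * dist x y" by (intro mult_left_mono) (auto simp: dist_commute)
        then show ?thesis using kd V[of x] V[of y] e by linarith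
      qed
    qed (use V in auto)
    moreover have "inf_conv (real k) V x \<le> V x" using inf_conv_le_self[of V B "real k" x] V by auto
    ultimately show ?thesis using e by simp
  qed
  then show "\<exists>no. \<forall>n\<ge>no. norm (inf_conv (real n) V x - V x) < e" by blast
qed

lemma integral_lower_semicontinuous_dist:
  fixes V :: "'a::polish_space \<Rightarrow> real"
  assumes V: "V \<in> bcontfun" and \<nu>: "\<nu> \<in> prob_measures" and a: "a < (\<integral>x. V x \<partial>\<nu>)"
  obtains \<rho> where "\<rho> > 0" "\<And>\<mu>. \<mu> \<in> prob_measures \<Longrightarrow> dual_lipschitz_dist \<nu> \<mu> < \<rho> \<Longrightarrow> a < (\<integral>x. V x \<partial>\<mu>)"
proof -
  obtain B where B: "0 \<le> B" "\<And>x. \<bar>V x\<bar> \<le> B" using bcontfun_boundE[OF V] by blast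
  interpret prob_space \<nu> using prob_measuresD[OF \<nu>] by simp
  have bc: "inf_conv (real k) V \<in> bcontfun" for k
    by (rule bounded_lipschitz_bcontfun, rule bounded_lipschitzI[where B=B and C="real k"])
      (auto intro: inf_conv_bound inf_conv_lipschitz B)
  have "(\<lambda>k. \<integral>x. inf_conv (real k) V x \<partial>\<nu>) \<longlonglongrightarrow> (\<integral>x. V x \<partial>\<nu>)"
  proof (rule integral_dominated_convergence[where w="\<lambda>_. B"])
    show "AE x in \<nu>. (\<lambda>k. inf_conv (real k) V x) \<longlonglongrightarrow> V x"
      using inf_conv_tendsto[OF bcontfun_continuous[OF V] B(2)] by simp
    show "AE x in \<nu>. norm (inf_conv (real k) V x) \<le> B" for k
      using inf_conv_bound[of V B "real k"] B(2) by simp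
  qed (auto intro: bcontfun_measurable_prob[OF \<nu>] V bc)
  \<comment> \<open>One Lipschitz minorant of \<open>V\<close> already has integral above
    \<open>a\<close>. Its integral varies by at most a constant times the distance, and it stays
    below \<open>V\<close> for every other measure.\<close>
  from order_tendstoD(1)[OF this a] obtain k where k: "a < (\<integral>x. inf_conv (real k) V x \<partial>\<nu>)"
    by (auto simp: eventually_sequentially)
  define \<epsilon> where "\<epsilon> = (\<integral>x. inf_conv (real k) V x \<partial>\<nu>) - a"
  define c where "c = B + real k + 1"
  have c: "c > 0" using B by (simp add: c_def)
  show ?thesis
  proof (rule that[of "\<epsilon> / c"])
    show "\<epsilon> / c > 0" using k c by (simp add: \<epsilon>_def)
    fix \<mu> :: "'a measure" assume \<mu>: "\<mu> \<in> prob_measures" and d: "dual_lipschitz_dist \<nu> \<mu> < \<epsilon> / c"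
    have "\<bar>(\<integral>x. inf_conv (real k) V x \<partial>\<nu>) - (\<integral>x. inf_conv (real k) V x \<partial>\<mu>)\<bar> \<le> c * dual_lipschitz_dist \<nu> \<mu>"
      unfolding c_def
      by (rule abs_integral_diff_le_dist[OF \<nu> \<mu>]) (auto intro: inf_conv_bound inf_conv_lipschitz B)
    also have "\<dots> < \<epsilon>" using d c by (simp add: field_simps)
    finally have "a < (\<integral>x. inf_conv (real k) V x \<partial>\<mu>)" by (simp add: \<epsilon>_def)
    also have "\<dots> \<le> (\<integral>x. V x \<partial>\<mu>)"
      using inf_conv_le_self[of V B "real k"] B(2) by (intro integral_mono integrable_bcontfun \<mu> V bc) auto
    finally show "a < (\<integral>x. V x \<partial>\<mu>)" .
  qed
qed

text \<open>The distance tests only Lipschitz functions, but at distance zero \<open>\<nu>\<close>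
  lies within every radius of \<open>\<mu>\<close>, so lower semicontinuity forbids the integral to
  drop from \<open>\<mu>\<close> to \<open>\<nu>\<close>. Applying this to \<open>V\<close> and
  \<open>- V\<close> gives equality.\<close>

lemma integral_eq_if_dist_zero:
  fixes V :: "'a::polish_space \<Rightarrow> real"
  assumes "\<mu> \<in> prob_measures" "\<nu> \<in> prob_measures" "dual_lipschitz_dist \<mu> \<nu> = 0" "V \<in> bcontfun"
  shows "(\<integral>x. V x \<partial>\<mu>) = (\<integral>x. V x \<partial>\<nu>)"
proof -
  have *: "(\<integral>x. W x \<partial>\<mu>) \<le> (\<integral>x. W x \<partial>\<nu>)" if W: "W \<in> bcontfun" for W :: "'a \<Rightarrow> real"
  proof (rule ccontr)
    assume "\<not> ?thesis"
    then have "(\<integral>x. W x \<partial>\<nu>) < (\<integral>x. W x \<partial>\<mu>)" by simp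
    then obtain \<rho> where "\<rho> > 0" "\<And>\<kappa>. \<kappa> \<in> prob_measures \<Longrightarrow> dual_lipschitz_dist \<mu> \<kappa> < \<rho> \<Longrightarrow> (\<integral>x. W x \<partial>\<nu>) < (\<integral>x. W x \<partial>\<kappa>)"
      using integral_lower_semicontinuous_dist[OF W assms(1)] by metis
    then show False using assms(2,3) by force
  qed
  have "(\<lambda>x. - V x) \<in> bcontfun" using assms(4) by (rule uminus_cont)
  then show ?thesis using *[OF assms(4)] *[of "\<lambda>x. - V x"] by simp
qed

text \<open>Integrals determine the measure of closed sets, whose indicators are limits of the
  continuous functions \<open>g F k\<close>; closed sets form an intersection-stable generator of
  the Borel sets.\<close>

lemma prob_measures_eqI:
  fixes \<mu> \<nu> :: "'a::polish_space measure"
  assumes \<mu>: "\<mu> \<in> prob_measures" and \<nu>: "\<nu> \<in> prob_measures"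
    and eq: "\<And>V::'a \<Rightarrow> real. V \<in> bcontfun \<Longrightarrow> (\<integral>x. V x \<partial>\<mu>) = (\<integral>x. V x \<partial>\<nu>)"
  shows "\<mu> = \<nu>"
proof -
  define g where "g F k x = max 0 (1 - real k * infdist x F)" for F :: "'a set" and k x
  \<comment> \<open>The empty set is treated apart: \<open>infdist x {}\<close> is 0 by convention,
    so there \<open>g\<close> would be constantly 1.\<close>
  have m: "measure \<mu> F = measure \<nu> F" if F: "closed F" "F \<noteq> {}" for F :: "'a set"
  proof -
    have bc: "g F k \<in> bcontfun" for k
      unfolding g_def by (rule bcontfunI[of _ 1]) (auto intro!: continuous_intros simp: infdist_nonneg)
    have pt: "(\<lambda>k. g F k x) \<longlonglongrightarrow> indicator F x" for x
    proof (cases "x \<in> F")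
      case True
      then show ?thesis by (simp add: g_def)
    next
      case False
      then have p: "infdist x F > 0" using F
        by (metis in_closed_iff_infdist_zero infdist_nonneg order_le_less)
      obtain K :: nat where K: "1 / infdist x F < real K" using reals_Archimedean2 by blast
      have "g F k x = 0" if "k \<ge> K" for k
      proof -
        have "1 < real K * infdist x F" using K p by (simp add: pos_divide_less_eq)
        also have "\<dots> \<le> real k * infdist x F" using that p by (intro mult_right_mono) auto
        finally show ?thesis by (simp add: g_def)
      qed
      then have "\<forall>\<^sub>F k in sequentially. g F k x = indicator F x"
        using False by (auto simp: eventually_sequentially)
      then show ?thesis by (rule tendsto_eventually)
    qed
    have lim: "(\<lambda>k. \<integral>x. g F k x \<partial>\<kappa>) \<longlonglongrightarrow> measure \<kappa> F" if \<kappa>: "\<kappa> \<in> prob_measures" for \<kappa> :: "'a measure"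
    proof -
      interpret prob_space \<kappa> using prob_measuresD[OF \<kappa>] by simp
      have F': "F \<in> sets \<kappa>" using F prob_measuresD[OF \<kappa>] by simp
      have "(\<lambda>k. \<integral>x. g F k x \<partial>\<kappa>) \<longlonglongrightarrow> (\<integral>x. indicator F x \<partial>\<kappa>)"
      proof (rule integral_dominated_convergence[where w="\<lambda>_. 1"])
        show "AE x in \<kappa>. norm (g F k x) \<le> 1" for k
          by (auto simp: g_def infdist_nonneg)
      qed (use F' pt in \<open>auto intro: bcontfun_measurable_prob[OF \<kappa> bc]\<close>)
      then show ?thesis using F' by simp
    qed
    show ?thesis using lim[OF \<mu>] lim[OF \<nu>] eq[OF bc] LIMSEQ_unique by fastforce
  qed
  interpret P: prob_space \<mu> using prob_measuresD[OF \<mu>] by simp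
  interpret Q: prob_space \<nu> using prob_measuresD[OF \<nu>] by simp
  show ?thesis
  proof (rule measure_eqI_generator_eq[where E="{F. closed F}" and \<Omega>=UNIV and A="\<lambda>_. UNIV"])
    show "emeasure \<mu> X = emeasure \<nu> X" if "X \<in> {F. closed F}" for X
      using that m[of X] by (cases "X = {}") (auto simp: P.emeasure_eq_measure Q.emeasure_eq_measure)
    show "sets \<mu> = sigma_sets UNIV {F. closed F}" "sets \<nu> = sigma_sets UNIV {F. closed F}"
      using prob_measuresD[OF \<mu>] prob_measuresD[OF \<nu>]
      by (simp_all add: borel_eq_closed)
  qed (auto simp: Int_stable_def)
qed

text \<open>The absolute value only matters outside \<open>prob_measures\<close>, where the locale
  \<open>Metric_space\<close> still demands nonnegativity.\<close>

definition weak_dist :: "'a::polish_space measure \<Rightarrow> 'a measure \<Rightarrow> real" where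
  "weak_dist \<mu> \<nu> = \<bar>dual_lipschitz_dist \<mu> \<nu>\<bar>"

lemma weak_dist_eq:
  "\<mu> \<in> prob_measures \<Longrightarrow> \<nu> \<in> prob_measures \<Longrightarrow> weak_dist \<mu> \<nu> = dual_lipschitz_dist \<mu> \<nu>"
  by (simp add: weak_dist_def dual_lipschitz_dist_nonneg)

interpretation weak: Metric_space "prob_measures :: 'a::polish_space measure set" weak_dist
proof
  have z: "dual_lipschitz_dist \<mu> \<mu> = 0" if "\<mu> \<in> prob_measures" for \<mu> :: "'a measure"
    using dual_lipschitz_dist_leI[of \<mu> \<mu> 0] dual_lipschitz_dist_nonneg[OF that that] by simp
  fix \<mu> \<nu> \<kappa> :: "'a measure"
  show "0 \<le> weak_dist \<mu> \<nu>" by (simp add: weak_dist_def)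
  show "weak_dist \<mu> \<nu> = weak_dist \<nu> \<mu>"
    by (simp add: weak_dist_def dual_lipschitz_dist_def abs_minus_commute)
  assume m: "\<mu> \<in> prob_measures" "\<nu> \<in> prob_measures"
  show "weak_dist \<mu> \<nu> = 0 \<longleftrightarrow> \<mu> = \<nu>"
    using m z prob_measures_eqI[OF m] integral_eq_if_dist_zero[OF m] by (auto simp: weak_dist_def)
  assume "\<kappa> \<in> prob_measures"
  then show "weak_dist \<mu> \<kappa> \<le> weak_dist \<mu> \<nu> + weak_dist \<nu> \<kappa>"
    using m by (simp add: weak_dist_eq dual_lipschitz_dist_triangle)
qed

subsection \<open>Bump functions along a dense sequence\<close>

definition bump :: "real \<Rightarrow> 'a::metric_space \<Rightarrow> 'a \<Rightarrow> real" where
  "bump \<delta> a y = max 0 (min 1 (2 - dist y a / \<delta>))"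

text \<open>A continuous substitute for the indicator of a union of \<open>n\<close> balls: it is 1
  within \<open>\<delta>\<close> of the centres and 0 at distance \<open>2 * \<delta>\<close> from
  all of them. Tightness thus becomes a condition on integrals of bounded continuous
  functions.\<close>

primrec bump_max :: "(nat \<Rightarrow> 'a::metric_space) \<Rightarrow> real \<Rightarrow> nat \<Rightarrow> 'a \<Rightarrow> real" where
  "bump_max x \<delta> 0 y = 0"
| "bump_max x \<delta> (Suc n) y = max (bump_max x \<delta> n y) (bump \<delta> (x n) y)"

lemma bump_bounds: "0 \<le> bump \<delta> a y" "bump \<delta> a y \<le> 1"
  by (auto simp: bump_def)

lemma bump_eq_0: "0 < \<delta> \<Longrightarrow> 2 * \<delta> \<le> dist y a \<Longrightarrow> bump \<delta> a y = 0"
  by (auto simp: bump_def field_simps)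

lemma bump_eq_1: "0 < \<delta> \<Longrightarrow> dist y a \<le> \<delta> \<Longrightarrow> bump \<delta> a y = 1"
  by (auto simp: bump_def field_simps)

lemma bump_max_bounds: "0 \<le> bump_max x \<delta> n y" "bump_max x \<delta> n y \<le> 1"
  by (induction n) (auto simp: bump_bounds le_max_iff_disj)

lemma bump_max_mono: "m \<le> n \<Longrightarrow> bump_max x \<delta> m y \<le> bump_max x \<delta> n y"
  by (induction n) (auto simp: le_Suc_eq le_max_iff_disj)

lemma bump_max_eq_1: "0 < \<delta> \<Longrightarrow> i < n \<Longrightarrow> dist y (x i) \<le> \<delta> \<Longrightarrow> bump_max x \<delta> n y = 1"
proof (induction n)
  case (Suc n)
  then show ?case
    using bump_max_bounds(2)[of x \<delta> n y] bump_bounds(2)[of \<delta> "x n" y]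
    by (cases "i = n") (auto simp: bump_eq_1)
qed simp

lemma bump_max_le_indicator:
  "0 < \<delta> \<Longrightarrow> bump_max x \<delta> n y \<le> indicator (\<Union>i<n. ball (x i) (2 * \<delta>)) y"
proof (induction n)
  case (Suc n)
  show ?case
  proof (cases "dist y (x n) < 2 * \<delta>")
    case True
    then have "y \<in> (\<Union>i<Suc n. ball (x i) (2 * \<delta>))" by (auto simp: dist_commute)
    then show ?thesis using bump_max_bounds(2)[of x \<delta> "Suc n" y] by simp
  next
    case False
    then have "bump_max x \<delta> (Suc n) y = bump_max x \<delta> n y"
      using Suc.prems bump_max_bounds(1)[of x \<delta> n y] by (simp add: bump_eq_0)
    also have "\<dots> \<le> indicator (\<Union>i<n. ball (x i) (2 * \<delta>)) y" by (rule Suc.IH[OF Suc.prems])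
    also have "\<dots> \<le> indicator (\<Union>i<Suc n. ball (x i) (2 * \<delta>)) y"
      by (auto simp: indicator_def lessThan_Suc)
    finally show ?thesis .
  qed
qed simp

lemma bump_max_continuous: "0 < \<delta> \<Longrightarrow> continuous_on UNIV (bump_max x \<delta> n)"
proof (induction n)
  case (Suc n)
  have "continuous_on UNIV (bump \<delta> (x n))"
    unfolding bump_def using Suc.prems by (intro continuous_intros) auto
  then show ?case using Suc by (auto intro!: continuous_on_max)
qed simp

lemma bump_max_bcontfun: "0 < \<delta> \<Longrightarrow> bump_max x \<delta> n \<in> bcontfun"
  using bump_max_bounds[of x \<delta> n] by (intro bcontfunI[of _ 1] bump_max_continuous) auto

text \<open>Tightness of a single measure: by density every point is within \<open>\<delta>\<close>
  of some \<open>x i\<close>, so the functions are eventually 1 pointwise, and dominated convergence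
  applies.\<close>

lemma bump_max_integral_tendsto:
  fixes x :: "nat \<Rightarrow> 'a::polish_space"
  assumes dense: "\<And>y e. 0 < e \<Longrightarrow> \<exists>i. dist y (x i) < e" and \<nu>: "\<nu> \<in> prob_measures" and \<delta>: "0 < \<delta>"
  shows "(\<lambda>n. \<integral>y. bump_max x \<delta> n y \<partial>\<nu>) \<longlonglongrightarrow> 1"
proof -
  interpret prob_space \<nu> using prob_measuresD[OF \<nu>] by simp
  have "(\<lambda>n. \<integral>y. bump_max x \<delta> n y \<partial>\<nu>) \<longlonglongrightarrow> (\<integral>y. 1 \<partial>\<nu>)"
  proof (rule integral_dominated_convergence[where w="\<lambda>_. 1"])
    have "(\<lambda>n. bump_max x \<delta> n y) \<longlonglongrightarrow> 1" for y
    proof -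
      obtain i where "dist y (x i) < \<delta>" using dense[OF \<delta>] by blast
      then have "\<forall>n\<ge>Suc i. bump_max x \<delta> n y = 1"
        using \<delta> by (auto intro!: bump_max_eq_1[of \<delta> i])
      then show ?thesis by (intro tendsto_eventually) (auto simp: eventually_sequentially)
    qed
    then show "AE y in \<nu>. (\<lambda>n. bump_max x \<delta> n y) \<longlonglongrightarrow> 1" by simp
    show "AE y in \<nu>. norm (bump_max x \<delta> n y) \<le> 1" for n
      using bump_max_bounds[of x \<delta> n] by auto
  qed (auto intro: bcontfun_measurable_prob[OF \<nu>] bump_max_bcontfun \<delta>)
  then show ?thesis by (simp add: prob_space)
qed

lemma dense_sequence_exists:
  obtains x :: "nat \<Rightarrow> 'a::polish_space" where "\<And>y e. 0 < e \<Longrightarrow> \<exists>i. dist y (x i) < e"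
proof -
  obtain D :: "'a set" where D: "countable D" "\<And>X. open X \<Longrightarrow> X \<noteq> {} \<Longrightarrow> \<exists>d\<in>D. d \<in> X"
    by (rule countable_dense_setE) blast
  have ne: "D \<noteq> {}" using D(2)[of UNIV] by auto
  show ?thesis
  proof (rule that[of "from_nat_into D"])
    fix y :: 'a and e :: real assume "0 < e"
    then obtain d where "d \<in> D" "d \<in> ball y e" using D(2)[of "ball y e"] by auto
    then show "\<exists>i. dist y (from_nat_into D i) < e"
      using from_nat_into_surj[OF D(1), of d] by auto
  qed
qed

subsection \<open>The dual Lipschitz distance metrizes the weak topology\<close>

lemma weak_topology_openin_integral:
  fixes V :: "'a::polish_space \<Rightarrow> real"
  assumes "V \<in> bcontfun" "open U"
  shows "openin weak_topology {\<mu> \<in> prob_measures. (\<integral>x. V x \<partial>\<mu>) \<in> U}"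
  unfolding weak_topology_def
  by (rule topology_generated_by_Basis, rule CollectI, rule exI[of _ V], rule exI[of _ U]) (simp add: assms)

lemma continuous_map_weak_integral:
  "V \<in> bcontfun \<Longrightarrow> continuous_map weak_topology euclideanreal (\<lambda>\<mu>. \<integral>x. V x \<partial>\<mu>)"
  by (auto simp: continuous_map_def intro: weak_topology_openin_integral)

text \<open>The increments of \<open>bump_max\<close> form a partition of unity with small supports; a 1-Lipschitz function
  is nearly constant on each support, so finitely many weak conditions control all such
  functions at once.\<close>

lemma weak_neighbourhood_dual_lipschitz:
  fixes \<nu> :: "'a::polish_space measure"
  assumes \<nu>: "\<nu> \<in> prob_measures" and e: "0 < e"
  obtains U where "openin weak_topology U" "\<nu> \<in> U" "\<And>\<mu>. \<mu> \<in> U \<Longrightarrow> dual_lipschitz_dist \<nu> \<mu> < e"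
proof -
  obtain x :: "nat \<Rightarrow> 'a" where dense: "\<And>y e. 0 < e \<Longrightarrow> \<exists>i. dist y (x i) < e"
    by (rule dense_sequence_exists) blast
  \<comment> \<open>Replacing \<open>f\<close> by \<open>g\<close> costs \<open>3 * \<delta>\<close>
    under each of the two measures, and comparing the integrals of \<open>g\<close> costs
    \<open>\<delta>\<close>; the total \<open>7 * \<delta>\<close> is below
    \<open>e\<close>.\<close>
  define \<delta> where "\<delta> = e / 16"
  have \<delta>: "0 < \<delta>" using e by (simp add: \<delta>_def)
  define h where "h = bump_max x \<delta>"
  define \<psi> where "\<psi> i y = h (Suc i) y - h i y" for i y
  have h: "h n \<in> bcontfun" for n unfolding h_def by (rule bump_max_bcontfun[OF \<delta>])
  have \<psi>: "\<psi> i \<in> bcontfun" for i unfolding \<psi>_def by (intro minus_cont h)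
  have h1: "(\<lambda>y. 1 - h n y) \<in> bcontfun" for n by (intro minus_cont h const_bcontfun)
  have "(\<lambda>n. \<integral>y. h n y \<partial>\<nu>) \<longlonglongrightarrow> 1"
    unfolding h_def by (rule bump_max_integral_tendsto[OF dense \<nu> \<delta>])
  then have "\<forall>\<^sub>F n in sequentially. 1 - \<delta> < (\<integral>y. h n y \<partial>\<nu>)"
    by (rule order_tendstoD(1)) (use \<delta> in simp)
  then obtain n where n: "1 - \<delta> < (\<integral>y. h n y \<partial>\<nu>)" by (auto simp: eventually_sequentially)
  \<comment> \<open>The \<open>n\<close> increments may each be off by \<open>\<eta>\<close>, in
    total at most \<open>\<delta>\<close>; \<open>Suc n\<close> avoids division by zero.\<close>
  define \<eta> where "\<eta> = \<delta> / real (Suc n)"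
  have \<eta>: "0 < \<eta>" using \<delta> by (simp add: \<eta>_def)
  define A where "A i = {\<mu> \<in> prob_measures. (\<integral>y. \<psi> i y \<partial>\<mu>) \<in> ball (\<integral>y. \<psi> i y \<partial>\<nu>) \<eta>}" for i
  \<comment> \<open>The inner \<open>prob_measures\<close> keeps the intersection inside the space
    when \<open>n\<close> is 0. The condition on \<open>h n\<close> limits the mass of
    \<open>\<mu>\<close> that the first \<open>n\<close> bumps miss.\<close>
  define U where "U = {\<mu> \<in> prob_measures. (\<integral>y. h n y \<partial>\<mu>) \<in> {1 - \<delta><..}} \<inter> (prob_measures \<inter> (\<Inter>i<n. A i))"
  have oA: "openin weak_topology (A i)" for i
    unfolding A_def by (rule weak_topology_openin_integral[OF \<psi> open_ball])
  have "openin weak_topology (prob_measures \<inter> (\<Inter>i<m. A i))" for m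
  proof (induction m)
    case 0
    show ?case using openin_topspace[of "weak_topology :: 'a measure topology"] by simp
  next
    case (Suc m)
    have "prob_measures \<inter> (\<Inter>i<Suc m. A i) = A m \<inter> (prob_measures \<inter> (\<Inter>i<m. A i))"
      by (auto simp: lessThan_Suc)
    then show ?case using openin_Int[OF oA Suc.IH] by simp
  qed
  then have "openin weak_topology U"
    unfolding U_def by (rule openin_Int[OF weak_topology_openin_integral[OF h open_greaterThan]])
  moreover have "\<nu> \<in> U" using \<nu> n \<eta> by (auto simp: U_def A_def)
  moreover have "dual_lipschitz_dist \<nu> \<mu> < e" if "\<mu> \<in> U" for \<mu>
  proof -
    have \<mu>: "\<mu> \<in> prob_measures" and \<mu>n: "1 - \<delta> < (\<integral>y. h n y \<partial>\<mu>)"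
      using that by (simp_all add: U_def)
    have \<mu>\<psi>: "\<bar>(\<integral>y. \<psi> i y \<partial>\<nu>) - (\<integral>y. \<psi> i y \<partial>\<mu>)\<bar> \<le> \<eta>" if "i < n" for i
    proof -
      have "\<mu> \<in> A i" using \<open>\<mu> \<in> U\<close> that by (simp add: U_def)
      then show ?thesis by (simp add: A_def dist_real_def)
    qed
    have "dual_lipschitz_dist \<nu> \<mu> \<le> 7 * \<delta>"
    proof (rule dual_lipschitz_dist_leI)
      fix f :: "'a \<Rightarrow> real"
      assume f: "f \<in> bcontfun" and fb: "\<And>y. \<bar>f y\<bar> \<le> 1" and fl: "\<And>y z. \<bar>f y - f z\<bar> \<le> dist y z"
      \<comment> \<open>\<open>g\<close> freezes \<open>f\<close> at the centre of each piece, so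
        its integral depends only on those of the \<open>n\<close> functions
        \<open>\<psi> i\<close>.\<close>
      define g where "g y = (\<Sum>i<n. f (x i) * \<psi> i y)" for y
      have hn: "h n y = (\<Sum>i<n. \<psi> i y)" for y
        unfolding \<psi>_def sum_lessThan_telescope[of "\<lambda>i. h i y"] by (simp add: h_def)
      have gb: "g \<in> bcontfun"
        unfolding g_def
      proof (induction n)
        case (Suc n)
        have "(\<lambda>y. (\<Sum>i<n. f (x i) * \<psi> i y) + f (x n) *\<^sub>R \<psi> n y) \<in> bcontfun"
          by (rule plus_cont[OF Suc scaleR_cont[OF \<psi>]])
        then show ?case by simp
      next
        case 0
        show ?case using const_bcontfun[of "0::real"] by simp
      qed
      \<comment> \<open>The first term is the variation of \<open>f\<close> over the support of a
        piece, the second the part of unity that the first \<open>n\<close> pieces do not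
        cover.\<close>
      have fg: "\<bar>f y - g y\<bar> \<le> 2 * \<delta> + (1 - h n y)" for y
      proof -
        have "\<bar>f y * \<psi> i y - f (x i) * \<psi> i y\<bar> \<le> 2 * \<delta> * \<psi> i y" for i
        proof (cases "dist y (x i) < 2 * \<delta>")
          case True
          then have "\<bar>f y - f (x i)\<bar> \<le> 2 * \<delta>" using fl[of y "x i"] by linarith
          moreover have "0 \<le> \<psi> i y" by (simp add: \<psi>_def h_def)
          moreover have "\<bar>f y * \<psi> i y - f (x i) * \<psi> i y\<bar> = \<bar>f y - f (x i)\<bar> * \<bar>\<psi> i y\<bar>"
            by (simp only: left_diff_distrib[symmetric] abs_mult)
          ultimately show ?thesis by (simp add: mult_right_mono)
        next
          case False
          then have "\<psi> i y = 0" using \<delta> bump_max_bounds(1)[of x \<delta> i y] by (simp add: \<psi>_def h_def bump_eq_0)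
          then show ?thesis by simp
        qed
        then have "(\<Sum>i<n. \<bar>f y * \<psi> i y - f (x i) * \<psi> i y\<bar>) \<le> (\<Sum>i<n. 2 * \<delta> * \<psi> i y)" by (intro sum_mono)
        also have "\<dots> = 2 * \<delta> * h n y" by (simp only: hn sum_distrib_left)
        also have "\<dots> \<le> 2 * \<delta>" using \<delta> bump_max_bounds[of x \<delta> n y] by (simp add: h_def)
        finally have "\<bar>f y * h n y - g y\<bar> \<le> 2 * \<delta>"
          using sum_abs[of "\<lambda>i. f y * \<psi> i y - f (x i) * \<psi> i y" "{..<n}"]
          by (simp only: hn g_def sum_distrib_left sum_subtractf)
        moreover have "\<bar>f y - f y * h n y\<bar> \<le> 1 - h n y"
        proof -
          have "f y - f y * h n y = f y * (1 - h n y)" by (simp add: right_diff_distrib)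
          then have "\<bar>f y - f y * h n y\<bar> = \<bar>f y\<bar> * \<bar>1 - h n y\<bar>" by (simp only: abs_mult)
          also have "\<dots> \<le> 1 * \<bar>1 - h n y\<bar>" by (intro mult_right_mono fb) simp
          finally show ?thesis using bump_max_bounds[of x \<delta> n y] by (simp add: h_def)
        qed
        ultimately show ?thesis by linarith
      qed
      have close: "\<bar>(\<integral>y. f y \<partial>\<kappa>) - (\<integral>y. g y \<partial>\<kappa>)\<bar> \<le> 3 * \<delta>"
        if \<kappa>: "\<kappa> \<in> prob_measures" and "1 - \<delta> < (\<integral>y. h n y \<partial>\<kappa>)" for \<kappa>
      proof -
        interpret prob_space \<kappa> using prob_measuresD[OF \<kappa>] by simp
        note i = integrable_bcontfun[OF \<kappa>]
        have "\<bar>(\<integral>y. f y \<partial>\<kappa>) - (\<integral>y. g y \<partial>\<kappa>)\<bar> = \<bar>\<integral>y. f y - g y \<partial>\<kappa>\<bar>" by (simp add: i f gb)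
        also have "\<dots> \<le> (\<integral>y. \<bar>f y - g y\<bar> \<partial>\<kappa>)" by (rule integral_abs_bound)
        also have "\<dots> \<le> (\<integral>y. 2 * \<delta> + (1 - h n y) \<partial>\<kappa>)"
        proof (rule integral_mono)
          show "integrable \<kappa> (\<lambda>y. \<bar>f y - g y\<bar>)" by (rule integrable_abs[OF i[OF minus_cont[OF f gb]]])
          show "integrable \<kappa> (\<lambda>y. 2 * \<delta> + (1 - h n y))" by (rule i[OF plus_cont[OF const_bcontfun h1]])
        qed (rule fg)
        also have "\<dots> = 2 * \<delta> + (1 - (\<integral>y. h n y \<partial>\<kappa>))" by (simp add: i h prob_space)
        finally show ?thesis using that by linarith
      qed
      have "\<bar>(\<integral>y. g y \<partial>\<nu>) - (\<integral>y. g y \<partial>\<mu>)\<bar> = \<bar>\<Sum>i<n. f (x i) * ((\<integral>y. \<psi> i y \<partial>\<nu>) - (\<integral>y. \<psi> i y \<partial>\<mu>))\<bar>"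
        unfolding g_def
        by (simp add: integrable_bcontfun \<mu> \<nu> \<psi> right_diff_distrib sum_subtractf)
      also have "\<dots> \<le> (\<Sum>i<n. \<bar>f (x i)\<bar> * \<bar>(\<integral>y. \<psi> i y \<partial>\<nu>) - (\<integral>y. \<psi> i y \<partial>\<mu>)\<bar>)"
        by (rule order_trans[OF sum_abs]) (simp add: abs_mult)
      also have "\<dots> \<le> (\<Sum>i<n. 1 * \<eta>)" using \<mu>\<psi> fb \<eta> by (intro sum_mono mult_mono) auto
      also have "\<dots> \<le> \<delta>" using \<delta> by (simp add: \<eta>_def field_simps)
      finally show "\<bar>(\<integral>y. f y \<partial>\<nu>) - (\<integral>y. f y \<partial>\<mu>)\<bar> \<le> 7 * \<delta>"
        using close[OF \<nu> n] close[OF \<mu> \<mu>n] by linarith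
    qed
    also have "\<dots> < e" using e by (simp add: \<delta>_def)
    finally show ?thesis .
  qed
  ultimately show ?thesis using that by blast
qed

lemma openin_weak_integral_metric:
  fixes V :: "'a::polish_space \<Rightarrow> real"
  assumes V: "V \<in> bcontfun" and U: "open U"
  shows "openin weak.mtopology {\<mu> \<in> prob_measures. (\<integral>x. V x \<partial>\<mu>) \<in> U}"
  unfolding weak.openin_mtopology
proof (intro conjI allI impI)
  fix \<nu> :: "'a measure" assume \<nu>: "\<nu> \<in> {\<mu> \<in> prob_measures. (\<integral>x. V x \<partial>\<mu>) \<in> U}"
  then have \<nu>': "\<nu> \<in> prob_measures" by simp
  obtain e where e: "e > 0" "ball (\<integral>x. V x \<partial>\<nu>) e \<subseteq> U"
    using \<nu> U by (auto simp: open_contains_ball)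
  obtain r1 where r1: "r1 > 0" "\<And>\<mu>. \<mu> \<in> prob_measures \<Longrightarrow> dual_lipschitz_dist \<nu> \<mu> < r1 \<Longrightarrow> (\<integral>x. V x \<partial>\<nu>) - e < (\<integral>x. V x \<partial>\<mu>)"
    by (rule integral_lower_semicontinuous_dist[OF V \<nu>', of "(\<integral>x. V x \<partial>\<nu>) - e"]) (use e in auto)
  \<comment> \<open>Lower semicontinuity for \<open>- V\<close> supplies the missing upper bound on
    the integral of \<open>V\<close>.\<close>
  have V': "(\<lambda>x. - V x) \<in> bcontfun" using V by (rule uminus_cont)
  obtain r2 where r2: "r2 > 0" "\<And>\<mu>. \<mu> \<in> prob_measures \<Longrightarrow> dual_lipschitz_dist \<nu> \<mu> < r2 \<Longrightarrow> (\<integral>x. - V x \<partial>\<nu>) - e < (\<integral>x. - V x \<partial>\<mu>)"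
    by (rule integral_lower_semicontinuous_dist[OF V' \<nu>', of "(\<integral>x. - V x \<partial>\<nu>) - e"]) (use e in auto)
  have "weak.mball \<nu> (min r1 r2) \<subseteq> {\<mu> \<in> prob_measures. (\<integral>x. V x \<partial>\<mu>) \<in> U}"
  proof
    fix \<mu> assume "\<mu> \<in> weak.mball \<nu> (min r1 r2)"
    then have "\<mu> \<in> prob_measures" "dual_lipschitz_dist \<nu> \<mu> < r1" "dual_lipschitz_dist \<nu> \<mu> < r2"
      by (auto simp: weak_dist_eq)
    moreover from this have "(\<integral>x. V x \<partial>\<mu>) \<in> ball (\<integral>x. V x \<partial>\<nu>) e"
      using r1(2)[of \<mu>] r2(2)[of \<mu>] by (auto simp: dist_real_def)
    ultimately show "\<mu> \<in> {\<mu> \<in> prob_measures. (\<integral>x. V x \<partial>\<mu>) \<in> U}" using e by auto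
  qed
  then show "\<exists>r>0. weak.mball \<nu> r \<subseteq> {\<mu> \<in> prob_measures. (\<integral>x. V x \<partial>\<mu>) \<in> U}"
    using r1(1) r2(1) by (intro exI[of _ "min r1 r2"]) auto
qed auto

text \<open>Generating sets of the weak topology are metrically open, and conversely every metric
  ball contains a weak neighbourhood of its centre.\<close>

lemma weak_topology_eq_mtopology:
  "(weak_topology :: 'a::polish_space measure topology) = weak.mtopology"
proof (rule topology_eq[THEN iffD2], intro allI iffI)
  fix U :: "'a measure set" assume "openin weak_topology U"
  then have "generate_topology_on {{\<mu> \<in> prob_measures. (\<integral>x. V x \<partial>\<mu>) \<in> U} | (V :: 'a \<Rightarrow> real) U. V \<in> bcontfun \<and> open U} U"
    unfolding weak_topology_def by (rule openin_topology_generated_by)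
  then show "openin weak.mtopology U"
    by induction (auto intro: openin_weak_integral_metric)
next
  fix U :: "'a measure set" assume U: "openin weak.mtopology U"
  show "openin weak_topology U"
  proof (subst openin_subopen, intro ballI)
    fix \<nu> assume "\<nu> \<in> U"
    then have \<nu>: "\<nu> \<in> prob_measures" and "\<exists>r>0. weak.mball \<nu> r \<subseteq> U"
      using U by (auto simp: weak.openin_mtopology)
    then obtain r where r: "r > 0" "weak.mball \<nu> r \<subseteq> U" by blast
    obtain W where W: "openin weak_topology W" "\<nu> \<in> W" "\<And>\<mu>. \<mu> \<in> W \<Longrightarrow> dual_lipschitz_dist \<nu> \<mu> < r"
      using weak_neighbourhood_dual_lipschitz[OF \<nu> r(1)] by blast
    have "W \<subseteq> prob_measures" using openin_subset[OF W(1)] by simp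
    then have "W \<subseteq> weak.mball \<nu> r" using W(3) \<nu> by (auto simp: weak_dist_eq)
    then show "\<exists>T. openin weak_topology T \<and> \<nu> \<in> T \<and> T \<subseteq> U" using W r by blast
  qed
qed

lemma prob_nhd_eq_Union:
  assumes "K \<subseteq> prob_measures"
  shows "prob_nhd K \<epsilon> = (\<Union>\<nu>\<in>K. weak.mball \<nu> \<epsilon>)"
proof (intro set_eqI iffI)
  fix \<mu> assume "\<mu> \<in> prob_nhd K \<epsilon>"
  then obtain \<nu> where "\<mu> \<in> prob_measures" "\<nu> \<in> K" "dual_lipschitz_dist \<mu> \<nu> < \<epsilon>"
    by (auto simp: prob_nhd_def)
  moreover from this have "weak_dist \<nu> \<mu> < \<epsilon>"
    using assms by (subst weak.commute) (auto simp: weak_dist_eq)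
  ultimately show "\<mu> \<in> (\<Union>\<nu>\<in>K. weak.mball \<nu> \<epsilon>)" using assms by auto
next
  fix \<mu> assume "\<mu> \<in> (\<Union>\<nu>\<in>K. weak.mball \<nu> \<epsilon>)"
  then obtain \<nu> where \<nu>: "\<nu> \<in> K" "\<mu> \<in> prob_measures" "\<nu> \<in> prob_measures" "weak_dist \<nu> \<mu> < \<epsilon>"
    by auto
  then have "weak_dist \<mu> \<nu> < \<epsilon>" by (subst weak.commute)
  then show "\<mu> \<in> prob_nhd K \<epsilon>" using \<nu> by (auto simp: prob_nhd_def weak_dist_eq)
qed

lemma openin_prob_nhd: "K \<subseteq> prob_measures \<Longrightarrow> openin weak_topology (prob_nhd K \<epsilon>)"
  by (auto simp: prob_nhd_eq_Union weak_topology_eq_mtopology)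

text \<open>A Lebesgue number of the one-element cover \<open>{U}\<close> of \<open>K\<close> is a
  radius that works at all points of \<open>K\<close> at once.\<close>

lemma compact_prob_nhd_subset:
  assumes K: "compactin weak_topology K" and U: "openin weak_topology U" and KU: "K \<subseteq> U"
  obtains \<epsilon> where "\<epsilon> > 0" "prob_nhd K \<epsilon> \<subseteq> U"
proof -
  have KP: "K \<subseteq> prob_measures" using compactin_subset_topspace[OF K] by simp
  obtain \<epsilon> where \<epsilon>: "\<epsilon> > 0" "\<forall>\<nu>\<in>K. weak.mball \<nu> \<epsilon> \<subseteq> U"
    using weak.lebesgue_number[of K "{U}"] K U KU by (auto simp: weak_topology_eq_mtopology)
  have "prob_nhd K \<epsilon> \<subseteq> (\<Union>\<nu>\<in>K. weak.mball \<nu> \<epsilon>)" using KP by (simp add: prob_nhd_eq_Union)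
  then show ?thesis using that \<epsilon> by blast
qed

section \<open>Relative compactness of tight families\<close>

subsection \<open>Random words with prescribed cylinder probabilities\<close>

text \<open>The words below are built from the right: \<open>i # t\<close> extends \<open>t\<close> by one letter. Each word \<open>s\<close> gets a
  half-open subinterval of \<open>[0, 1)\<close> of length \<open>p s\<close>, the intervals of the extensions
  \<open>i # t\<close> being placed side by side in the interval of \<open>t\<close>.\<close>

primrec left_end :: "(nat list \<Rightarrow> real) \<Rightarrow> nat list \<Rightarrow> real" where
  "left_end p [] = 0"
| "left_end p (i # t) = left_end p t + (\<Sum>j<i. p (j # t))"

text \<open>For \<open>u\<close> in the interval of \<open>t\<close>, this is the letter of the
  extension whose interval contains \<open>u\<close>: the first one whose right end exceeds
  \<open>u\<close>.\<close>

definition next_letter :: "(nat list \<Rightarrow> real) \<Rightarrow> real \<Rightarrow> nat list \<Rightarrow> nat" where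
  "next_letter p u t = (LEAST i. u < left_end p t + (\<Sum>j<Suc i. p (j # t)))"

primrec interval_word :: "(nat list \<Rightarrow> real) \<Rightarrow> real \<Rightarrow> nat \<Rightarrow> nat list" where
  "interval_word p u 0 = []"
| "interval_word p u (Suc k) = next_letter p u (interval_word p u k) # interval_word p u k"

definition word_interval :: "(nat list \<Rightarrow> real) \<Rightarrow> nat list \<Rightarrow> real set" where
  "word_interval p s = {left_end p s ..< left_end p s + p s}"

lemma length_interval_word [simp]: "length (interval_word p u k) = k"
  by (induction k) auto

context
  fixes p :: "nat list \<Rightarrow> real"
  assumes p_nonneg: "\<And>s. 0 \<le> p s" and p_Nil: "p [] = 1" and p_sums: "\<And>t. (\<lambda>i. p (i # t)) sums p t"
begin

lemma partial_sum_le: "(\<Sum>j<n. p (j # t)) \<le> p t"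
  using sum_le_suminf[OF sums_summable[OF p_sums], of "{..<n}" t] p_nonneg sums_unique[OF p_sums, of t] by simp

lemma partial_sum_mono: "m \<le> n \<Longrightarrow> (\<Sum>j<m. p (j # t)) \<le> (\<Sum>j<n. p (j # t))"
  using p_nonneg by (intro sum_mono2) auto

lemma word_interval_subset: "word_interval p (i # t) \<subseteq> word_interval p t"
proof -
  have "0 \<le> (\<Sum>j<i. p (j # t))" by (intro sum_nonneg p_nonneg)
  then show ?thesis using partial_sum_le[where n="Suc i" and t=t]
    by (auto simp: word_interval_def)
qed

text \<open>The right ends of the subintervals converge to that of the interval of \<open>t\<close>.
  As this interval is half-open, \<open>u\<close> lies strictly below the limit, so some right end
  passes \<open>u\<close>; minimality puts \<open>u\<close> at or after the left end.\<close>

lemma next_letter_interval: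
  assumes u: "u \<in> word_interval p t"
  shows "u \<in> word_interval p (next_letter p u t # t)"
proof -
  let ?P = "\<lambda>i. u < left_end p t + (\<Sum>j<Suc i. p (j # t))"
  have "(\<lambda>n. \<Sum>j<n. p (j # t)) \<longlonglongrightarrow> p t" using p_sums[of t] by (simp add: sums_def)
  moreover have "u - left_end p t < p t" using u by (simp add: word_interval_def)
  ultimately have "\<forall>\<^sub>F n in sequentially. u - left_end p t < (\<Sum>j<n. p (j # t))"
    by (rule order_tendstoD)
  then obtain n where n: "u < left_end p t + (\<Sum>j<n. p (j # t))"
    by (auto simp: eventually_sequentially algebra_simps)
  moreover have "(\<Sum>j<n. p (j # t)) \<le> (\<Sum>j<Suc n. p (j # t))" by (rule partial_sum_mono) simp
  ultimately have "?P n" by linarith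
  then have L: "?P (next_letter p u t)" unfolding next_letter_def by (rule LeastI)
  have "left_end p t + (\<Sum>j<next_letter p u t. p (j # t)) \<le> u"
  proof (cases "next_letter p u t")
    case 0
    then show ?thesis using u by (simp add: word_interval_def)
  next
    case (Suc i)
    then have "\<not> ?P i" using not_less_Least[of i ?P] by (simp add: next_letter_def)
    then show ?thesis using Suc by simp
  qed
  then show ?thesis using L by (simp add: word_interval_def)
qed

lemma next_letter_eq:
  assumes "u \<in> word_interval p (i # t)"
  shows "next_letter p u t = i"
  unfolding next_letter_def
proof (rule Least_equality)
  show "u < left_end p t + (\<Sum>j<Suc i. p (j # t))" using assms by (simp add: word_interval_def)
  fix k assume k: "u < left_end p t + (\<Sum>j<Suc k. p (j # t))"
  show "i \<le> k"
  proof (rule ccontr)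
    assume "\<not> i \<le> k"
    then have "(\<Sum>j<Suc k. p (j # t)) \<le> (\<Sum>j<i. p (j # t))" by (intro partial_sum_mono) simp
    then show False using k assms by (simp add: word_interval_def)
  qed
qed

lemma interval_word_eq_iff:
  assumes "u \<in> {0..<1}"
  shows "interval_word p u (length s) = s \<longleftrightarrow> u \<in> word_interval p s"
proof (induction s)
  case Nil
  show ?case using assms by (simp add: word_interval_def p_Nil)
next
  case (Cons i t)
  show ?case
    using Cons next_letter_interval[of u t] next_letter_eq[of u i t] word_interval_subset[of i t] by auto
qed

lemma word_interval_subset_unit: "word_interval p s \<subseteq> {0..<1}"
proof (induction s)
  case Nil
  show ?case by (simp add: word_interval_def p_Nil)
next
  case (Cons i t)
  then show ?case using word_interval_subset by blast
qed

text \<open>An interval that contains \<open>u\<close> has positive length. This holds for every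
  \<open>u\<close>, not just almost every one, so words can later be decoded pointwise.\<close>

lemma interval_word_prob_pos:
  assumes "u \<in> {0..<1}"
  shows "0 < p (interval_word p u k)"
proof -
  have "u \<in> word_interval p (interval_word p u k)"
    using interval_word_eq_iff[OF assms, of "interval_word p u k"] by simp
  then show ?thesis by (auto simp: word_interval_def)
qed

text \<open>Under Lebesgue measure on \<open>[0, 1)\<close>, the event that the random word equals
  \<open>s\<close> is the interval of \<open>s\<close>, whose length is \<open>p s\<close>.\<close>

lemma random_word_exists:
  obtains P :: "real measure" and Z :: "real \<Rightarrow> nat \<Rightarrow> nat list" where
    "prob_space P"
    "\<And>u k. length (Z u k) = k"
    "\<And>u k. tl (Z u (Suc k)) = Z u k"
    "\<And>u k. u \<in> space P \<Longrightarrow> 0 < p (Z u k)"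
    "\<And>k. (\<lambda>u. Z u k) \<in> measurable P (count_space UNIV)"
    "\<And>s. measure P {u \<in> space P. Z u (length s) = s} = p s"
proof
  let ?P = "restrict_space lborel {0..<1::real}"
  show "prob_space ?P"
    by (rule prob_spaceI) (simp add: emeasure_restrict_space space_restrict_space)
  have cyl: "{u \<in> space ?P. interval_word p u (length s) = s} = word_interval p s" for s
  proof (rule set_eqI)
    fix u
    show "u \<in> {u \<in> space ?P. interval_word p u (length s) = s} \<longleftrightarrow> u \<in> word_interval p s"
      using interval_word_eq_iff[of u s] subsetD[OF word_interval_subset_unit[of s], of u]
      by (auto simp: space_restrict_space)
  qed
  have sets: "word_interval p s \<in> sets ?P" for s
    using word_interval_subset_unit[of s] by (simp add: sets_restrict_space_iff) (simp add: word_interval_def)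
  show "measure ?P {u \<in> space ?P. interval_word p u (length s) = s} = p s" for s
    unfolding cyl using word_interval_subset_unit[of s] p_nonneg[of s]
    by (simp add: measure_restrict_space) (simp add: word_interval_def)
  show "(\<lambda>u. interval_word p u k) \<in> measurable ?P (count_space UNIV)" for k
  proof (rule measurable_count_space_eq2_countable[THEN iffD2], intro conjI ballI)
    fix s :: "nat list"
    show "(\<lambda>u. interval_word p u k) -` {s} \<inter> space ?P \<in> sets ?P"
    proof (cases "length s = k")
      case True
      then show ?thesis using sets[of s] cyl[of s] by (simp add: vimage_def Int_def conj_commute)
    next
      case False
      then have "(\<lambda>u. interval_word p u k) -` {s} \<inter> space ?P = {}" by auto
      then show ?thesis by simp
    qed
  qed auto
qed (auto intro: interval_word_prob_pos simp: space_restrict_space)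

end

subsection \<open>Coding a separable space by words\<close>

text \<open>In place of a diagonal argument: a countable power of \<open>[0, 1]\<close> is compact
  and metrizable, hence sequentially compact.\<close>

lemma countable_pointwise_subsequence:
  fixes f :: "nat \<Rightarrow> 'c::countable \<Rightarrow> real"
  assumes "\<And>n c. f n c \<in> {0..1}"
  obtains \<phi> l where "strict_mono \<phi>" "\<And>c. (\<lambda>n. f (\<phi> n) c) \<longlonglongrightarrow> l c"
proof -
  have "compactin (product_topology (\<lambda>_. euclidean) UNIV) (PiE (UNIV::'c set) (\<lambda>_. {0..1::real}))"
    by (simp add: compactin_PiE)
  then have "seq_compact (PiE (UNIV::'c set) (\<lambda>_. {0..1::real}))"
    by (simp add: euclidean_product_topology compact_eq_seq_compact_metric)
  then obtain l \<phi> where \<phi>: "strict_mono (\<phi> :: nat \<Rightarrow> nat)" and l: "(f \<circ> \<phi>) \<longlonglongrightarrow> l"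
    by (rule seq_compactE[where f=f]) (use assms in auto)
  have "(\<lambda>n. f (\<phi> n) c) \<longlonglongrightarrow> l c" for c
    using continuous_on_tendsto_compose[OF continuous_on_product_coordinates l, of c] by simp
  then show ?thesis using that \<phi> by blast
qed

text \<open>Not a closest point but the first point of the sequence within the tolerance; taking the
  least index makes the choice measurable.\<close>

definition nearest :: "(nat \<Rightarrow> 'a::metric_space) \<Rightarrow> nat \<Rightarrow> 'a \<Rightarrow> nat" where
  "nearest x k y = (LEAST i. dist y (x i) < (1/2)^k)"

text \<open>The newest letter comes first, so these words grow by the same left extensions as the
  words that index the intervals.\<close>

primrec point_word :: "(nat \<Rightarrow> 'a::metric_space) \<Rightarrow> nat \<Rightarrow> 'a \<Rightarrow> nat list" where
  "point_word x 0 y = []"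
| "point_word x (Suc k) y = nearest x k y # point_word x k y"

lemma length_point_word [simp]: "length (point_word x k y) = k"
  by (induction k) auto

lemma nearest_measurable: "nearest x k \<in> measurable borel (count_space UNIV)"
proof -
  have "Measurable.pred borel (\<lambda>y. dist y (x i) < (1/2)^k)" for i
    using open_Collect_less[of "\<lambda>y. dist y (x i)" "\<lambda>_. (1/2)^k"]
    by (simp add: pred_def borel_open continuous_intros)
  then show ?thesis unfolding nearest_def by (rule measurable_Least)
qed

lemma point_word_measurable: "point_word x k \<in> measurable borel (count_space UNIV)"
proof (induction k)
  case (Suc k)
  note [measurable] = Suc nearest_measurable
  show ?case by simp
qed simp

lemma word_prefix_eq:
  assumes "\<And>k. tl (z (Suc k)) = z k" and "point_word x K y = z K" and "j \<le> K"
  shows "point_word x j y = z j"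
  using assms(3,2)
proof (induction rule: inc_induct)
  case (step k)
  then show ?case using assms(1)[of k] by (metis list.sel(3) point_word.simps(2))
qed

text \<open>Replacing \<open>Y\<close> by the centre coded by \<open>Z\<close> costs at most
  \<open>\<epsilon>\<close> while \<open>Z\<close> lies in \<open>S\<close>, and at most 1 on the
  rest, which has probability at most \<open>\<eta>\<close>. This reduces integrals to finite sums
  of word probabilities, both for the given measures and for the limit.\<close>

lemma word_approximation:
  fixes f :: "'a::polish_space \<Rightarrow> real" and c :: "nat list \<Rightarrow> 'a"
  assumes P: "prob_space P" and Y: "Y \<in> measurable P borel"
    and Z: "Z \<in> measurable P (count_space UNIV)"
    and close: "\<And>u. u \<in> space P \<Longrightarrow> dist (Y u) (c (Z u)) \<le> \<epsilon>"
    and S: "finite S" "1 - \<eta> \<le> (\<Sum>s\<in>S. measure P {u \<in> space P. Z u = s})"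
    and f: "f \<in> bcontfun" "\<And>y. \<bar>f y\<bar> \<le> 1" "\<And>y z. \<bar>f y - f z\<bar> \<le> dist y z" and \<epsilon>: "0 \<le> \<epsilon>"
  shows "\<bar>(\<integral>u. f (Y u) \<partial>P) - (\<Sum>s\<in>S. f (c s) * measure P {u \<in> space P. Z u = s})\<bar> \<le> \<epsilon> + \<eta>"
proof -
  interpret prob_space P by (rule P)
  define E where "E s = {u \<in> space P. Z u = s}" for s
  have E[measurable]: "E s \<in> sets P" for s
    unfolding E_def using Z by measurable
  define g where "g u = (\<Sum>s\<in>S. f (c s) * indicator (E s) u)" for u
  define h where "h u = (\<Sum>s\<in>S. indicator (E s) u :: real)" for u
  have gi: "integrable P g" and hi: "integrable P h"
    unfolding g_def h_def by (auto intro!: Bochner_Integration.integrable_sum integrable_mult_right simp: emeasure_eq_measure)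
  have [measurable]: "f \<in> borel_measurable borel" by (rule bcontfun_measurable[OF f(1)])
  note Y[measurable]
  have fi: "integrable P (\<lambda>u. f (Y u))"
    using f(2) by (intro integrable_const_bound[of _ 1]) auto
  have bound: "\<bar>f (Y u) - g u\<bar> \<le> \<epsilon> + (1 - h u)" if u: "u \<in> space P" for u
  proof (cases "Z u \<in> S")
    case True
    have "g u = (\<Sum>s\<in>S. if s = Z u then f (c s) else 0)"
      unfolding g_def using u by (intro sum.cong) (auto simp: E_def indicator_def)
    then have "g u = f (c (Z u))" using True S by simp
    moreover have "h u = (\<Sum>s\<in>S. if s = Z u then 1 else 0)"
      unfolding h_def using u by (intro sum.cong) (auto simp: E_def indicator_def)
    then have "h u = 1" using True S by simp
    ultimately show ?thesis using f(3)[of "Y u" "c (Z u)"] close[OF u] by simp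
  next
    case False
    then have "g u = 0" "h u = 0"
      unfolding g_def h_def by (auto intro!: sum.neutral simp: E_def indicator_def)
    then show ?thesis using f(2)[of "Y u"] \<epsilon> by simp
  qed
  have "\<bar>(\<integral>u. f (Y u) \<partial>P) - (\<integral>u. g u \<partial>P)\<bar> = \<bar>\<integral>u. f (Y u) - g u \<partial>P\<bar>" using fi gi by simp
  also have "\<dots> \<le> (\<integral>u. \<bar>f (Y u) - g u\<bar> \<partial>P)" by (rule integral_abs_bound)
  also have "\<dots> \<le> (\<integral>u. \<epsilon> + (1 - h u) \<partial>P)"
    using fi gi hi bound by (intro integral_mono) auto
  also have "\<dots> = \<epsilon> + (1 - (\<integral>u. h u \<partial>P))" using hi by (simp add: prob_space)
  also have "(\<integral>u. h u \<partial>P) = (\<Sum>s\<in>S. measure P (E s))"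
    unfolding h_def by (subst Bochner_Integration.integral_sum) (auto simp: emeasure_eq_measure)
  also have "(\<integral>u. g u \<partial>P) = (\<Sum>s\<in>S. f (c s) * measure P (E s))"
    unfolding g_def by (subst Bochner_Integration.integral_sum) (auto simp: emeasure_eq_measure)
  finally show ?thesis using S(2) by (simp add: E_def)
qed

context
  fixes x :: "nat \<Rightarrow> 'a::polish_space"
  assumes dense: "\<And>y e. 0 < e \<Longrightarrow> \<exists>i. dist y (x i) < e"
begin

lemma dist_nearest: "dist y (x (nearest x k y)) < (1/2)^k"
proof -
  have "\<exists>i. dist y (x i) < (1/2)^k" by (rule dense) simp
  then show ?thesis unfolding nearest_def by (rule LeastI_ex)
qed

text \<open>Compatible letters of a word sequence are centres of balls with a common point, so they form a
  fast Cauchy sequence; completeness decodes the sequence.\<close>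

lemma decode_words:
  assumes "\<And>k. tl (z (Suc k)) = z k" and "\<And>k. \<exists>y. point_word x k y = z k"
  shows "\<exists>l. (\<lambda>k. x (hd (z (Suc k)))) \<longlonglongrightarrow> l \<and> (\<forall>k. dist l (x (hd (z (Suc k)))) \<le> (1/2)^k)"
proof -
  define c where "c k = x (hd (z (Suc k)))" for k
  have pair: "dist (c j) (c k) \<le> (1/2)^j + (1/2)^k" for j k
  proof -
    \<comment> \<open>A point with the longer word also has all shorter ones, so it is close to both
      centres.\<close>
    obtain y where y: "point_word x (Suc (max j k)) y = z (Suc (max j k))" using assms(2) by blast
    have near: "dist y (c i) \<le> (1/2)^i" if "i \<le> max j k" for i
    proof -
      have "point_word x (Suc i) y = z (Suc i)"
        using that by (intro word_prefix_eq[OF assms(1) y]) auto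
      then have "hd (z (Suc i)) = nearest x i y" by (metis list.sel(1) point_word.simps(2))
      then show ?thesis using dist_nearest[of y i] by (simp add: c_def)
    qed
    show ?thesis using dist_triangle2[of "c j" "c k" y] near[of j] near[of k] by (simp add: dist_commute)
  qed
  have half: "(\<lambda>k. (1/2::real)^k) \<longlonglongrightarrow> 0" by (rule LIMSEQ_power_zero) simp
  have "Cauchy c"
  proof (rule metric_CauchyI)
    fix e :: real assume "0 < e"
    then obtain N where N: "(1/2)^N < e / 2"
      using order_tendstoD(2)[OF half, of "e/2"] by (auto simp: eventually_sequentially)
    have "dist (c m) (c n) < e" if "m \<ge> N" "n \<ge> N" for m n
    proof -
      have "(1/2::real)^m \<le> (1/2)^N" "(1/2::real)^n \<le> (1/2)^N"
        using that by (auto intro!: power_decreasing)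
      then show ?thesis using pair[of m n] N by linarith
    qed
    then show "\<exists>M. \<forall>m\<ge>M. \<forall>n\<ge>M. dist (c m) (c n) < e" by blast
  qed
  then obtain l where l: "c \<longlonglongrightarrow> l" using Cauchy_convergent convergent_def by blast
  have "dist l (c k) \<le> (1/2)^k" for k
  proof (rule tendsto_le[OF sequentially_bot])
    show "(\<lambda>j. dist (c j) (c k)) \<longlonglongrightarrow> dist l (c k)" by (intro tendsto_intros l)
    show "(\<lambda>j. (1/2)^j + (1/2)^k) \<longlonglongrightarrow> (1/2::real)^k"
      using tendsto_add[OF half tendsto_const[of "(1/2)^k"]] by simp
  qed (simp add: pair)
  then show ?thesis using l by (auto simp: c_def[abs_def])
qed

text \<open>Prokhorov's theorem for sequences. Tightness is phrased through the code: at each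
  accuracy, finitely many letters carry all but \<open>\<eta>\<close> of the mass of every
  \<open>\<sigma> m\<close>.\<close>

lemma tight_sequence_convergent_subsequence:
  fixes \<sigma> :: "nat \<Rightarrow> 'a measure"
  assumes \<sigma>: "\<And>m. \<sigma> m \<in> prob_measures"
    and tight: "\<And>k \<eta>::real. 0 < \<eta> \<Longrightarrow> \<exists>n. \<forall>m. 1 - \<eta> \<le> measure (\<sigma> m) {y. nearest x k y < n}"
  obtains \<phi> \<mu> where "strict_mono \<phi>" "\<mu> \<in> prob_measures" "(\<lambda>m. dual_lipschitz_dist (\<sigma> (\<phi> m)) \<mu>) \<longlonglongrightarrow> 0"
proof -
  note ps = prob_measuresD(1)[OF \<sigma>] and sp = prob_measuresD(3)[OF \<sigma>]
  have fm: "finite_measure (\<sigma> m)" for m using ps[of m] by (rule prob_space.finite_measure)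
  define q where "q m s = measure (\<sigma> m) {y. point_word x (length s) y = s}" for m s
  have wm: "point_word x k \<in> measurable (\<sigma> m) (count_space UNIV)" for k m
    using point_word_measurable measurable_cong_sets[OF prob_measuresD(2)[OF \<sigma>]] by blast
  have nm: "nearest x k \<in> measurable (\<sigma> m) (count_space UNIV)" for k m
    using nearest_measurable measurable_cong_sets[OF prob_measuresD(2)[OF \<sigma>]] by blast
  have cs: "{y. point_word x k y \<in> S} \<in> sets (\<sigma> m)" for S k m
    using measurable_sets[OF wm, of S k m] by (simp add: sp vimage_def)
  have ns: "{y. nearest x k y < n} \<in> sets (\<sigma> m)" for n k m
    using measurable_sets[OF nm, of "{..<n}" k m] by (simp add: sp vimage_def)
  have cs1: "{y. point_word x k y = s} \<in> sets (\<sigma> m)" for s k m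
    using cs[of k "{s}" m] by simp
  have qsum: "measure (\<sigma> m) {y. point_word x k y \<in> S} = (\<Sum>s\<in>S. q m s)"
    if "finite S" "\<forall>s\<in>S. length s = k" for S k m
  proof -
    have "{y. point_word x k y \<in> S} = (\<Union>s\<in>S. {y. point_word x k y = s})" by auto
    moreover have "measure (\<sigma> m) (\<Union>s\<in>S. {y. point_word x k y = s}) = (\<Sum>s\<in>S. measure (\<sigma> m) {y. point_word x k y = s})"
      using cs1 by (intro finite_measure.finite_measure_finite_Union[OF fm that(1)])
        (auto simp: disjoint_family_on_def)
    ultimately show ?thesis using that(2) by (simp add: q_def)
  qed
  have "q m s \<in> {0..1}" for m s
    using prob_space.prob_le_1[OF ps] by (simp add: q_def)
  then obtain \<phi> p where \<phi>: "strict_mono \<phi>" and p: "\<And>s. (\<lambda>m. q (\<phi> m) s) \<longlonglongrightarrow> p s"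
    using countable_pointwise_subsequence[of q] by blast
  have p_nonneg: "0 \<le> p s" for s
    by (rule LIMSEQ_le_const[OF p]) (simp add: q_def)
  have q_Nil: "q m [] = 1" for m using prob_space.prob_space[OF ps[of m]] by (simp add: q_def sp)
  then have "(\<lambda>m. q (\<phi> m) []) \<longlonglongrightarrow> 1" by simp
  then have p_Nil: "p [] = 1" by (rule LIMSEQ_unique[OF p])
  have qext: "(\<Sum>i<n. q m (i # t)) = measure (\<sigma> m) ({y. point_word x (length t) y = t} \<inter> {y. nearest x (length t) y < n})"
    for n m t
  proof -
    have "(\<Sum>i<n. q m (i # t)) = (\<Sum>s\<in>(\<lambda>i. i # t) ` {..<n}. q m s)"
      by (subst sum.reindex) (auto simp: inj_on_def)
    also have "\<dots> = measure (\<sigma> m) {y. point_word x (Suc (length t)) y \<in> (\<lambda>i. i # t) ` {..<n}}"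
      by (rule qsum[symmetric]) auto
    also have "{y. point_word x (Suc (length t)) y \<in> (\<lambda>i. i # t) ` {..<n}} =
        {y. point_word x (length t) y = t} \<inter> {y. nearest x (length t) y < n}" by auto
    finally show ?thesis .
  qed
  have split: "measure (\<sigma> m) A - \<eta> \<le> measure (\<sigma> m) (A \<inter> B)"
    if "A \<in> sets (\<sigma> m)" "B \<in> sets (\<sigma> m)" "1 - \<eta> \<le> measure (\<sigma> m) B" for m A B \<eta>
  proof -
    interpret prob_space "\<sigma> m" by (rule ps)
    have "prob A = prob (A \<inter> B) + prob (A - B)"
      using finite_measure_Diff'[OF that(1,2)] by simp
    also have "prob (A - B) \<le> prob (space (\<sigma> m) - B)"
      using that sets.sets_into_space by (intro finite_measure_mono) auto
    also have "\<dots> = 1 - prob B" by (rule prob_compl[OF that(2)])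
    finally show ?thesis using that(3) by linarith
  qed
  \<comment> \<open>No mass escapes in the limit: the cutoff \<open>n\<close> is the same for all
    \<open>m\<close>, so the lower bound on the finite partial sum passes to
    \<open>p\<close>.\<close>
  have p_sums: "(\<lambda>i. p (i # t)) sums p t" for t
    unfolding sums_def
  proof (rule LIMSEQ_I)
    fix e :: real assume e: "0 < e"
    obtain n where n: "\<And>m. 1 - e / 2 \<le> measure (\<sigma> m) {y. nearest x (length t) y < n}"
      using tight[of "e / 2"] e by auto
    have lim: "(\<lambda>m. \<Sum>i<k. q (\<phi> m) (i # t)) \<longlonglongrightarrow> (\<Sum>i<k. p (i # t))" for k
      by (intro tendsto_sum p)
    have "(\<Sum>i<k. q m (i # t)) \<le> q m t" for k m
      unfolding qext unfolding q_def using cs1 ns by (intro finite_measure.finite_measure_mono fm) auto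
    then have up: "(\<Sum>i<k. p (i # t)) \<le> p t" for k
      by (intro LIMSEQ_le[OF lim p]) auto
    have "q m t - e / 2 \<le> (\<Sum>i<n. q m (i # t))" for m
      unfolding qext using split[OF cs1 ns n] by (simp add: q_def)
    then have lo: "p t - e / 2 \<le> (\<Sum>i<n. p (i # t))"
      by (intro LIMSEQ_le[OF tendsto_diff[OF p tendsto_const] lim]) auto
    have "norm ((\<Sum>i<k. p (i # t)) - p t) < e" if "k \<ge> n" for k
    proof -
      have "(\<Sum>i<n. p (i # t)) \<le> (\<Sum>i<k. p (i # t))"
        using that p_nonneg by (intro sum_mono2) auto
      then show ?thesis using up[of k] lo e by simp
    qed
    then show "\<exists>no. \<forall>k\<ge>no. norm ((\<Sum>i<k. p (i # t)) - p t) < e" by blast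
  qed
  \<comment> \<open>Finitely many words of each length carry almost all mass, uniformly in
    \<open>m\<close>; half of \<open>\<eta>\<close> is spent on the shorter word and half on the new
    letter.\<close>
  have trunc: "\<exists>S. finite S \<and> (\<forall>s\<in>S. length s = k) \<and> (\<forall>m. 1 - \<eta> \<le> (\<Sum>s\<in>S. q m s))" if "0 < \<eta>" for k and \<eta> :: real
    using that
  proof (induction k arbitrary: \<eta>)
    case 0
    show ?case using 0 q_Nil by (intro exI[of _ "{[]}"]) auto
  next
    case (Suc k)
    obtain S where S: "finite S" "\<forall>s\<in>S. length s = k" "\<And>m. 1 - \<eta> / 2 \<le> (\<Sum>s\<in>S. q m s)"
      using Suc.IH[of "\<eta> / 2"] Suc.prems by auto
    obtain n where n: "\<And>m. 1 - \<eta> / 2 \<le> measure (\<sigma> m) {y. nearest x k y < n}"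
      using tight[of "\<eta> / 2"] Suc.prems by auto
    define T where "T = (\<lambda>(i, t). i # t) ` ({..<n} \<times> S)"
    have T: "finite T" "\<forall>s\<in>T. length s = Suc k" using S by (auto simp: T_def)
    have "1 - \<eta> \<le> (\<Sum>s\<in>T. q m s)" for m
    proof -
      have eq: "{y. point_word x (Suc k) y \<in> T} = {y. point_word x k y \<in> S} \<inter> {y. nearest x k y < n}"
        by (auto simp: T_def)
      have "(1 - \<eta> / 2) - \<eta> / 2 \<le> measure (\<sigma> m) {y. point_word x k y \<in> S} - \<eta> / 2"
        using S(3)[of m] qsum[OF S(1,2)] by simp
      also have "\<dots> \<le> measure (\<sigma> m) {y. point_word x (Suc k) y \<in> T}"
        unfolding eq by (rule split[OF cs ns n])
      finally show ?thesis using qsum[OF T] by simp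
    qed
    then show ?case using T by blast
  qed
  obtain P Z where P: "prob_space (P :: real measure)" and Zl: "\<And>u k. length (Z u k) = k"
    and Zt: "\<And>u k. tl (Z u (Suc k)) = Z u k" and Zp: "\<And>u k. u \<in> space P \<Longrightarrow> 0 < p (Z u k)"
    and Zm: "\<And>k. (\<lambda>u. Z u k) \<in> measurable P (count_space UNIV)"
    and Zs: "\<And>s. measure P {u \<in> space P. Z u (length s) = s} = p s"
    by (rule random_word_exists[of p, OF p_nonneg p_Nil p_sums], rule that)
  \<comment> \<open>A word with positive limit probability cannot have probability zero under every
    \<open>\<sigma> m\<close>, so some point realises it; this makes its letters compatible.\<close>
  have nonempty: "\<exists>y. point_word x k y = Z u k" if "u \<in> space P" for u k
  proof (rule ccontr)
    assume "\<not> ?thesis"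
    then have "q m (Z u k) = 0" for m by (simp add: q_def Zl)
    then have "(\<lambda>m. q (\<phi> m) (Z u k)) \<longlonglongrightarrow> 0" by simp
    then have "p (Z u k) = 0" by (rule LIMSEQ_unique[OF p])
    then show False using Zp[OF that, of k] by simp
  qed
  define Y where "Y u = (if u \<in> space P then lim (\<lambda>k. x (hd (Z u (Suc k)))) else undefined)" for u
  have Y: "(\<lambda>k. x (hd (Z u (Suc k)))) \<longlonglongrightarrow> Y u" "dist (Y u) (x (hd (Z u (Suc k)))) \<le> (1/2)^k"
    if u: "u \<in> space P" for u k
  proof -
    obtain l where l: "(\<lambda>k. x (hd (Z u (Suc k)))) \<longlonglongrightarrow> l" "\<And>k. dist l (x (hd (Z u (Suc k)))) \<le> (1/2)^k"
      using decode_words[of "Z u", OF Zt nonempty[OF u]] by blast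
    then have "Y u = l" using u by (simp add: Y_def limI)
    then show "(\<lambda>k. x (hd (Z u (Suc k)))) \<longlonglongrightarrow> Y u" "dist (Y u) (x (hd (Z u (Suc k)))) \<le> (1/2)^k"
      using l by auto
  qed
  have Ym: "Y \<in> measurable P borel"
  proof (rule borel_measurable_LIMSEQ_metric)
    show "(\<lambda>u. x (hd (Z u (Suc k)))) \<in> borel_measurable P" for k
      using measurable_compose[OF Zm[of "Suc k"], of "\<lambda>s. x (hd s)" borel] by simp
  qed (rule Y)
  define \<mu> where "\<mu> = distr P borel Y"
  have \<mu>: "\<mu> \<in> prob_measures"
    using prob_space.prob_space_distr[OF P Ym] by (simp add: \<mu>_def prob_measures_def)
  have "(\<lambda>m. dual_lipschitz_dist (\<sigma> (\<phi> m)) \<mu>) \<longlonglongrightarrow> 0"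
  proof (rule LIMSEQ_I)
    fix e :: real assume e: "0 < e"
    have half: "(\<lambda>k. (1/2::real)^k) \<longlonglongrightarrow> 0" by (rule LIMSEQ_power_zero) simp
    obtain k where k: "(1/2)^k < e / 8"
      using order_tendstoD(2)[OF half, of "e/8"] e by (auto simp: eventually_sequentially)
    \<comment> \<open>The head of a word of length \<open>Suc k\<close> codes a point to accuracy
      \<open>(1/2)^k\<close>. The two approximations by finite sums cost at most
      \<open>2 * (e / 8)\<close> each, and comparing the sums costs \<open>e / 8\<close>.\<close>
    obtain S where S: "finite S" "\<forall>s\<in>S. length s = Suc k" "\<And>m. 1 - e / 8 \<le> (\<Sum>s\<in>S. q m s)"
      using trunc[of "e / 8" "Suc k"] e by auto
    have Sp: "1 - e / 8 \<le> (\<Sum>s\<in>S. p s)"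
      using S(3) by (intro LIMSEQ_le_const[OF tendsto_sum[OF p]]) auto
    have "(\<lambda>m. \<Sum>s\<in>S. \<bar>q (\<phi> m) s - p s\<bar>) \<longlonglongrightarrow> (\<Sum>s\<in>S. \<bar>p s - p s\<bar>)"
      by (intro tendsto_intros p)
    then have "\<forall>\<^sub>F m in sequentially. (\<Sum>s\<in>S. \<bar>q (\<phi> m) s - p s\<bar>) < e / 8"
      by (rule order_tendstoD) (use e in simp)
    then obtain N where N: "\<And>m. m \<ge> N \<Longrightarrow> (\<Sum>s\<in>S. \<bar>q (\<phi> m) s - p s\<bar>) < e / 8"
      by (auto simp: eventually_sequentially)
    have "norm (dual_lipschitz_dist (\<sigma> (\<phi> m)) \<mu> - 0) < e" if m: "m \<ge> N" for m
    proof -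
      have "dual_lipschitz_dist (\<sigma> (\<phi> m)) \<mu> \<le> 5 * (e / 8)"
      proof (rule dual_lipschitz_dist_leI)
        fix f :: "'a \<Rightarrow> real"
        assume f: "f \<in> bcontfun" "\<And>y. \<bar>f y\<bar> \<le> 1" "\<And>y z. \<bar>f y - f z\<bar> \<le> dist y z"
        have eqs: "measure (\<sigma> (\<phi> m)) {y \<in> space (\<sigma> (\<phi> m)). point_word x (Suc k) y = s} = q (\<phi> m) s"
          "measure P {u \<in> space P. Z u (Suc k) = s} = p s" if "s \<in> S" for s
          using S(2) that Zs[of s] by (simp_all add: q_def sp)
        have "\<bar>(\<integral>y. f y \<partial>\<sigma> (\<phi> m)) -
            (\<Sum>s\<in>S. f (x (hd s)) * measure (\<sigma> (\<phi> m)) {y \<in> space (\<sigma> (\<phi> m)). point_word x (Suc k) y = s})\<bar>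
            \<le> (1/2)^k + e / 8"
        proof (rule word_approximation[OF ps measurable_ident_sets[OF prob_measuresD(2)[OF \<sigma>]] wm _ S(1) _ f])
          show "dist y (x (hd (point_word x (Suc k) y))) \<le> (1/2)^k" for y
            using dist_nearest[of y k] by simp
          show "1 - e / 8 \<le> (\<Sum>s\<in>S. measure (\<sigma> (\<phi> m)) {y \<in> space (\<sigma> (\<phi> m)). point_word x (Suc k) y = s})"
            using S(3)[of "\<phi> m"] eqs(1) by simp
        qed simp
        then have 1: "\<bar>(\<integral>y. f y \<partial>\<sigma> (\<phi> m)) - (\<Sum>s\<in>S. f (x (hd s)) * q (\<phi> m) s)\<bar> \<le> (1/2)^k + e / 8"
          using eqs(1) by (simp cong: sum.cong)
        have "\<bar>(\<integral>u. f (Y u) \<partial>P) - (\<Sum>s\<in>S. f (x (hd s)) * measure P {u \<in> space P. Z u (Suc k) = s})\<bar>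
            \<le> (1/2)^k + e / 8"
        proof (rule word_approximation[OF P Ym Zm _ S(1) _ f])
          show "dist (Y u) (x (hd (Z u (Suc k)))) \<le> (1/2)^k" if "u \<in> space P" for u
            by (rule Y(2)[OF that])
          show "1 - e / 8 \<le> (\<Sum>s\<in>S. measure P {u \<in> space P. Z u (Suc k) = s})"
            using Sp eqs(2) by simp
        qed simp
        then have 2: "\<bar>(\<integral>u. f (Y u) \<partial>P) - (\<Sum>s\<in>S. f (x (hd s)) * p s)\<bar> \<le> (1/2)^k + e / 8"
          using eqs(2) by (simp cong: sum.cong)
        have "(\<integral>y. f y \<partial>\<mu>) = (\<integral>u. f (Y u) \<partial>P)"
          unfolding \<mu>_def by (rule integral_distr[OF Ym bcontfun_measurable[OF f(1)]])
        moreover have "\<bar>(\<Sum>s\<in>S. f (x (hd s)) * q (\<phi> m) s) - (\<Sum>s\<in>S. f (x (hd s)) * p s)\<bar> \<le> (\<Sum>s\<in>S. \<bar>q (\<phi> m) s - p s\<bar>)"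
        proof -
          have "\<bar>(\<Sum>s\<in>S. f (x (hd s)) * q (\<phi> m) s) - (\<Sum>s\<in>S. f (x (hd s)) * p s)\<bar> =
              \<bar>\<Sum>s\<in>S. f (x (hd s)) * (q (\<phi> m) s - p s)\<bar>"
            by (simp add: sum_subtractf right_diff_distrib)
          also have "\<dots> \<le> (\<Sum>s\<in>S. \<bar>f (x (hd s)) * (q (\<phi> m) s - p s)\<bar>)" by (rule sum_abs)
          also have "\<dots> \<le> (\<Sum>s\<in>S. 1 * \<bar>q (\<phi> m) s - p s\<bar>)"
            unfolding abs_mult by (intro sum_mono mult_right_mono f) simp
          finally show ?thesis by simp
        qed
        ultimately show "\<bar>(\<integral>y. f y \<partial>\<sigma> (\<phi> m)) - (\<integral>y. f y \<partial>\<mu>)\<bar> \<le> 5 * (e / 8)"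
          using 1 2 N[OF m] k by linarith
      qed
      then show ?thesis using dual_lipschitz_dist_nonneg[OF \<sigma> \<mu>, of "\<phi> m"] e by simp
    qed
    then show "\<exists>no. \<forall>m\<ge>no. norm (dual_lipschitz_dist (\<sigma> (\<phi> m)) \<mu> - 0) < e" by blast
  qed
  then show ?thesis using that \<phi> \<mu> by blast
qed

lemma compactin_weak_topology_tight:
  assumes T: "closedin weak_topology T"
    and tight: "\<And>\<delta> \<eta>::real. 0 < \<delta> \<Longrightarrow> 0 < \<eta> \<Longrightarrow> \<exists>n. \<forall>\<mu>\<in>T. 1 - \<eta> \<le> (\<integral>y. bump_max x \<delta> n y \<partial>\<mu>)"
  shows "compactin weak_topology T"
  unfolding weak_topology_eq_mtopology weak.compactin_sequentially
proof (intro conjI allI impI)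
  show TP: "T \<subseteq> prob_measures" using closedin_subset[OF T] by simp
  fix \<sigma> :: "nat \<Rightarrow> 'a measure" assume \<sigma>T: "range \<sigma> \<subseteq> T"
  then have \<sigma>: "\<sigma> m \<in> prob_measures" for m using TP by blast
  have tight': "\<exists>n. \<forall>m. 1 - \<eta> \<le> measure (\<sigma> m) {y. nearest x k y < n}" if \<eta>: "0 < \<eta>" for k and \<eta> :: real
  proof -
    \<comment> \<open>The bumps vanish outside balls of radius
      \<open>2 * \<delta> = (1/2)^k\<close>, exactly the tolerance of \<open>nearest x k\<close>, so
      any point where \<open>bump_max x \<delta> n\<close> is positive has a letter below
      \<open>n\<close>.\<close>
    define \<delta> :: real where "\<delta> = (1/2)^k / 2"
    have \<delta>: "0 < \<delta>" by (simp add: \<delta>_def)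
    obtain n where n: "\<And>\<mu>. \<mu> \<in> T \<Longrightarrow> 1 - \<eta> \<le> (\<integral>y. bump_max x \<delta> n y \<partial>\<mu>)"
      using tight[OF \<delta> \<eta>] by blast
    have "1 - \<eta> \<le> measure (\<sigma> m) {y. nearest x k y < n}" for m
    proof -
      interpret prob_space "\<sigma> m" using prob_measuresD[OF \<sigma>] by blast
      define B where "B = (\<Union>i<n. ball (x i) (2 * \<delta>))"
      have B: "B \<in> sets (\<sigma> m)" using prob_measuresD(2)[OF \<sigma>] by (auto simp: B_def)
      have "1 - \<eta> \<le> (\<integral>y. bump_max x \<delta> n y \<partial>\<sigma> m)" using n \<sigma>T by blast
      also have "\<dots> \<le> (\<integral>y. indicator B y \<partial>\<sigma> m)"
      proof (rule integral_mono)
        show "integrable (\<sigma> m) (bump_max x \<delta> n)"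
          by (intro integrable_bcontfun \<sigma> bump_max_bcontfun \<delta>)
      qed (use B bump_max_le_indicator[OF \<delta>] in \<open>auto simp: B_def emeasure_eq_measure\<close>)
      also have "\<dots> = prob B" using B by simp
      also have "\<dots> \<le> measure (\<sigma> m) {y. nearest x k y < n}"
      proof (rule finite_measure_mono)
        have "nearest x k \<in> measurable (\<sigma> m) (count_space UNIV)"
          using nearest_measurable measurable_cong_sets[OF prob_measuresD(2)[OF \<sigma>]] by blast
        from measurable_sets[OF this, of "{..<n}"]
        show "{y. nearest x k y < n} \<in> events" by (simp add: prob_measuresD(3)[OF \<sigma>] vimage_def)
        have "nearest x k y < n" if "i < n" "dist y (x i) < (1/2)^k" for i y
          using Least_le[of "\<lambda>i. dist y (x i) < (1/2)^k" i] that by (simp add: nearest_def)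
        then show "B \<subseteq> {y. nearest x k y < n}" by (auto simp: B_def \<delta>_def dist_commute)
      qed
      finally show ?thesis .
    qed
    then show ?thesis by blast
  qed
  obtain \<phi> \<mu> where \<phi>: "strict_mono \<phi>" and \<mu>: "\<mu> \<in> prob_measures"
    and lim: "(\<lambda>m. dual_lipschitz_dist (\<sigma> (\<phi> m)) \<mu>) \<longlonglongrightarrow> 0"
    using tight_sequence_convergent_subsequence[OF \<sigma> tight'] by blast
  have limit: "limitin weak.mtopology (\<sigma> \<circ> \<phi>) \<mu> sequentially"
    unfolding weak.limitin_metric
  proof (intro conjI allI impI \<mu>)
    fix e :: real assume "0 < e"
    then have "\<forall>\<^sub>F m in sequentially. dual_lipschitz_dist (\<sigma> (\<phi> m)) \<mu> < e"
      using lim by (intro order_tendstoD)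
    then show "\<forall>\<^sub>F m in sequentially. (\<sigma> \<circ> \<phi>) m \<in> prob_measures \<and> weak_dist ((\<sigma> \<circ> \<phi>) m) \<mu> < e"
      by eventually_elim (simp add: weak_dist_eq \<sigma> \<mu>)
  qed
  moreover have "\<mu> \<in> T"
    using weak.metric_closedin_iff_sequentially_closed[of T] T limit \<sigma>T
    by (auto simp: weak_topology_eq_mtopology) (metis comp_apply image_subset_iff rangeI range_subsetD)
  ultimately show "\<exists>l r. l \<in> T \<and> strict_mono r \<and> limitin weak.mtopology (\<sigma> \<circ> r) l sequentially"
    using \<phi> by blast
qed

end

section \<open>Exponential asymptotics along a filter\<close>

text \<open>Directedness makes the sections a filter base, so a single section decides membership in
  the infimum.\<close>

lemma eventually_net_filter:
  assumes "directed_set \<Theta> prec"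
  shows "eventually P (net_filter \<Theta> prec) \<longleftrightarrow> (\<exists>\<theta>0\<in>\<Theta>. \<forall>\<theta>\<in>\<Theta>. prec \<theta>0 \<theta> \<longrightarrow> P \<theta>)"
  unfolding net_filter_def
proof (subst eventually_INF_base)
  show "\<Theta> \<noteq> {}" using assms by (simp add: directed_set_def)
  fix a b assume ab: "a \<in> \<Theta>" "b \<in> \<Theta>"
  then obtain c where "c \<in> \<Theta>" "prec a c" "prec b c" using assms by (auto simp: directed_set_def)
  moreover have "transp_on \<Theta> prec" using assms by (simp add: directed_set_def)
  ultimately show "\<exists>c\<in>\<Theta>. principal {\<theta> \<in> \<Theta>. prec c \<theta>} \<le> inf (principal {\<theta> \<in> \<Theta>. prec a \<theta>}) (principal {\<theta> \<in> \<Theta>. prec b \<theta>})"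
    using ab by (intro bexI[of _ c]) (auto dest: transp_onD)
qed (auto simp: eventually_principal)

lemma net_filter_neq_bot:
  assumes "directed_set \<Theta> prec"
  shows "net_filter \<Theta> prec \<noteq> bot"
proof
  assume "net_filter \<Theta> prec = bot"
  then have "eventually (\<lambda>_. False) (net_filter \<Theta> prec)" by simp
  then show False using assms unfolding eventually_net_filter[OF assms]
    by (auto simp: directed_set_def dest: reflp_onD)
qed

lemma eventually_in_net:
  assumes "directed_set \<Theta> prec"
  shows "\<forall>\<^sub>F \<theta> in net_filter \<Theta> prec. \<theta> \<in> \<Theta>"
  using assms by (auto simp: eventually_net_filter directed_set_def)

text \<open>For \<open>a \<le> 0\<close> both sides hold, the logarithm being
  \<open>-\<infinity>\<close>; otherwise this is monotonicity of \<open>exp\<close>.\<close>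

lemma scaled_elog_le_iff:
  assumes "0 < r"
  shows "ereal (1 / r) * elog a \<le> ereal c \<longleftrightarrow> a \<le> exp (r * c)"
proof (cases "a \<le> 0")
  case True
  then have "a \<le> exp (r * c)" using exp_ge_zero[of "r * c"] by linarith
  then show ?thesis using True assms by (simp add: elog_def)
next
  case False
  then have "a \<le> exp (r * c) \<longleftrightarrow> ln a \<le> r * c" using ln_ge_iff[of a] by (metis exp_le_cancel_iff exp_ln not_le)
  then show ?thesis using False assms by (simp add: elog_def field_simps)
qed

lemma less_scaled_elog_iff:
  "0 < r \<Longrightarrow> ereal c < ereal (1 / r) * elog a \<longleftrightarrow> exp (r * c) < a"
  using scaled_elog_le_iff[of r a c] by (simp add: not_le[symmetric])

text \<open>A bound \<open>< c\<close> on the upper growth rate of \<open>a\<close>, free of logarithms so that sums and products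
  are treated by real arithmetic.\<close>

definition exp_below :: "'i filter \<Rightarrow> ('i \<Rightarrow> real) \<Rightarrow> ('i \<Rightarrow> real) \<Rightarrow> real \<Rightarrow> bool" where
  "exp_below N r a c \<longleftrightarrow> (\<exists>c0<c. \<forall>\<^sub>F \<theta> in N. a \<theta> \<le> exp (r \<theta> * c0))"

lemma exp_below_mono:
  assumes "exp_below N r b c" "\<forall>\<^sub>F \<theta> in N. a \<theta> \<le> b \<theta>"
  shows "exp_below N r a c"
proof -
  obtain c0 where c0: "c0 < c" "\<forall>\<^sub>F \<theta> in N. b \<theta> \<le> exp (r \<theta> * c0)" using assms by (auto simp: exp_below_def)
  from assms(2) c0(2) have "\<forall>\<^sub>F \<theta> in N. a \<theta> \<le> exp (r \<theta> * c0)" by eventually_elim (rule order_trans)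
  then show ?thesis using c0(1) by (auto simp: exp_below_def)
qed

lemma exp_below_scale:
  assumes "exp_below N r a c"
  shows "exp_below N r (\<lambda>\<theta>. exp (r \<theta> * d) * a \<theta>) (d + c)"
proof -
  obtain c0 where c0: "c0 < c" "\<forall>\<^sub>F \<theta> in N. a \<theta> \<le> exp (r \<theta> * c0)" using assms by (auto simp: exp_below_def)
  from c0(2) have "\<forall>\<^sub>F \<theta> in N. exp (r \<theta> * d) * a \<theta> \<le> exp (r \<theta> * (d + c0))"
    by eventually_elim (simp add: distrib_left exp_add)
  then show ?thesis using c0(1) unfolding exp_below_def by (intro exI[of _ "d + c0"]) auto
qed

lemma exp_below_exp: "c0 < c \<Longrightarrow> exp_below N r (\<lambda>\<theta>. exp (r \<theta> * c0)) c"
  unfolding exp_below_def by (intro exI[of _ c0]) auto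

lemma exp_below_0: "exp_below N r (\<lambda>_. 0) c"
  unfolding exp_below_def by (intro exI[of _ "c - 1"]) auto

context
  fixes N :: "'i filter" and r :: "'i \<Rightarrow> real"
  assumes r: "filterlim r at_top N"
begin

lemma eventually_r_gt: "\<forall>\<^sub>F \<theta> in N. c < r \<theta>"
  using r by (simp add: filterlim_at_top_dense)

text \<open>The sum is at most twice the term of larger rate, and since \<open>r\<close> tends to
  infinity a slightly larger rate absorbs the factor 2.\<close>

lemma exp_below_add:
  assumes "exp_below N r a c" "exp_below N r b c"
  shows "exp_below N r (\<lambda>\<theta>. a \<theta> + b \<theta>) c"
proof -
  obtain c1 where c1: "c1 < c" "\<forall>\<^sub>F \<theta> in N. a \<theta> \<le> exp (r \<theta> * c1)" using assms by (auto simp: exp_below_def)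
  obtain c2 where c2: "c2 < c" "\<forall>\<^sub>F \<theta> in N. b \<theta> \<le> exp (r \<theta> * c2)" using assms by (auto simp: exp_below_def)
  define m where "m = max c1 c2"
  obtain m' where m': "m < m'" "m' < c" using dense[of m c] c1 c2 by (auto simp: m_def)
  have "\<forall>\<^sub>F \<theta> in N. a \<theta> + b \<theta> \<le> exp (r \<theta> * m')"
    using c1(2) c2(2) eventually_r_gt[of "ln 2 / (m' - m)"] eventually_r_gt[of 0]
  proof eventually_elim
    case (elim \<theta>)
    have "exp (r \<theta> * c1) \<le> exp (r \<theta> * m)" "exp (r \<theta> * c2) \<le> exp (r \<theta> * m)"
      using elim by (simp_all add: m_def)
    then have "a \<theta> + b \<theta> \<le> 2 * exp (r \<theta> * m)" using elim(1,2) by linarith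
    also have "\<dots> = exp (ln 2 + r \<theta> * m)" by (simp add: exp_add)
    also have "exp (ln 2 + r \<theta> * m) \<le> exp (r \<theta> * m')"
    proof -
      have "ln 2 + r \<theta> * m \<le> r \<theta> * m'" using elim m' by (simp add: field_simps)
      then show ?thesis by simp
    qed
    finally show ?case .
  qed
  then show ?thesis using m' unfolding exp_below_def by blast
qed

lemma exp_below_sum:
  assumes "finite J" "\<And>j. j \<in> J \<Longrightarrow> exp_below N r (a j) c"
  shows "exp_below N r (\<lambda>\<theta>. \<Sum>j\<in>J. a j \<theta>) c"
  using assms by (induction J) (auto intro: exp_below_add simp: exp_below_0)

lemma exp_below_imp_Limsup_le:
  assumes "exp_below N r a c"
  shows "Limsup N (\<lambda>\<theta>. ereal (1 / r \<theta>) * elog (a \<theta>)) \<le> ereal c"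
proof -
  obtain c0 where c0: "c0 < c" "\<forall>\<^sub>F \<theta> in N. a \<theta> \<le> exp (r \<theta> * c0)" using assms by (auto simp: exp_below_def)
  have "\<forall>\<^sub>F \<theta> in N. ereal (1 / r \<theta>) * elog (a \<theta>) \<le> ereal c0"
    using c0(2) eventually_r_gt[of 0] by eventually_elim (simp add: scaled_elog_le_iff)
  then have "Limsup N (\<lambda>\<theta>. ereal (1 / r \<theta>) * elog (a \<theta>)) \<le> ereal c0" by (rule Limsup_bounded)
  then show ?thesis using c0(1) order_trans[of _ "ereal c0" "ereal c"] by simp
qed

lemma Limsup_less_imp_exp_below:
  assumes "Limsup N (\<lambda>\<theta>. ereal (1 / r \<theta>) * elog (a \<theta>)) < ereal c"
  shows "exp_below N r a c"
proof -
  obtain c0 where c0: "Limsup N (\<lambda>\<theta>. ereal (1 / r \<theta>) * elog (a \<theta>)) < ereal c0" "c0 < c"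
    using ereal_dense2[OF assms] by auto
  have "\<forall>\<^sub>F \<theta> in N. a \<theta> \<le> exp (r \<theta> * c0)"
    using Limsup_lessD[OF c0(1)] eventually_r_gt[of 0]
    by eventually_elim (auto simp: scaled_elog_le_iff[symmetric])
  then show ?thesis using c0(2) by (auto simp: exp_below_def)
qed

lemma Liminf_geI:
  assumes "\<And>c'. c' < c \<Longrightarrow> \<forall>\<^sub>F \<theta> in N. exp (r \<theta> * c') < a \<theta>"
  shows "ereal c \<le> Liminf N (\<lambda>\<theta>. ereal (1 / r \<theta>) * elog (a \<theta>))"
proof (rule ccontr)
  assume "\<not> ?thesis"
  then obtain z where z: "Liminf N (\<lambda>\<theta>. ereal (1 / r \<theta>) * elog (a \<theta>)) < ereal z" "z < c"
    using ereal_dense2[of "Liminf N (\<lambda>\<theta>. ereal (1 / r \<theta>) * elog (a \<theta>))" "ereal c"] by (auto simp: not_le)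
  have "\<forall>\<^sub>F \<theta> in N. ereal z \<le> ereal (1 / r \<theta>) * elog (a \<theta>)"
    using assms[OF z(2)] eventually_r_gt[of 0]
    by eventually_elim (simp add: less_imp_le less_scaled_elog_iff)
  then have "ereal z \<le> Liminf N (\<lambda>\<theta>. ereal (1 / r \<theta>) * elog (a \<theta>))" by (rule Liminf_bounded)
  then show False using z(1) by simp
qed

end

section \<open>The large deviation principle\<close>

lemma space_weak_borel: "space weak_borel = prob_measures"
  using openin_subset[of weak_topology]
  unfolding weak_borel_def by (intro space_measure_of) auto

lemma openin_sets_weak_borel: "openin weak_topology U \<Longrightarrow> U \<in> sets weak_borel"
  using openin_subset[of weak_topology] unfolding weak_borel_def by auto

lemma prob_measures_sets_weak_borel [simp]: "prob_measures \<in> sets weak_borel"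
  using openin_sets_weak_borel[OF openin_topspace] by simp

lemma closedin_sets_weak_borel:
  assumes "closedin weak_topology F"
  shows "F \<in> sets weak_borel"
proof -
  have "prob_measures - (prob_measures - F) \<in> sets weak_borel"
    using sets.Diff[OF prob_measures_sets_weak_borel openin_sets_weak_borel[of "prob_measures - F"]] assms
    by (simp add: closedin_def)
  moreover have "prob_measures - (prob_measures - F) = F" using closedin_subset[OF assms] by auto
  ultimately show ?thesis by simp
qed

locale exp_tight_net = prob_space M for M :: "'w measure" +
  fixes N :: "'i filter" and L :: "'i \<Rightarrow> 'w \<Rightarrow> 'a::polish_space measure" and r :: "'i \<Rightarrow> real"
  assumes N: "N \<noteq> bot"
    and L_ev: "\<forall>\<^sub>F \<theta> in N. L \<theta> \<in> measurable M weak_borel"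
    and r: "filterlim r at_top N"
    and AET: "\<And>l::real. 0 < l \<Longrightarrow> \<exists>K. compactin weak_topology K \<and>
           (\<forall>\<epsilon>>0. Limsup N (\<lambda>\<theta>. ereal (1 / r \<theta>) *
                elog (measure M {\<omega> \<in> space M. L \<theta> \<omega> \<in> prob_measures - prob_nhd K \<epsilon>}))
              \<le> ereal (- l))"
begin

text \<open>The exponential moment restricted to the event that \<open>L \<theta>\<close> lies in
  \<open>A\<close>. The potential 0 gives the probability of the event, and
  \<open>A = prob_measures\<close> gives the moment in the pressure.\<close>

definition partition_fn :: "('a \<Rightarrow> real) \<Rightarrow> 'a measure set \<Rightarrow> 'i \<Rightarrow> real" where
  "partition_fn V A \<theta> = (\<integral>\<omega>. exp (r \<theta> * (\<integral>x. V x \<partial>L \<theta> \<omega>)) * indicator A (L \<theta> \<omega>) \<partial>M)"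

context
  fixes \<theta> :: 'i assumes L\<theta>: "L \<theta> \<in> measurable M weak_borel" and r\<theta>: "0 < r \<theta>"
begin

lemma L_prob: "\<omega> \<in> space M \<Longrightarrow> L \<theta> \<omega> \<in> prob_measures"
  using measurable_space[OF L\<theta>] by (simp add: space_weak_borel)

lemma L_integral_measurable:
  fixes V :: "'a \<Rightarrow> real"
  assumes "V \<in> bcontfun"
  shows "(\<lambda>\<omega>. \<integral>x. V x \<partial>L \<theta> \<omega>) \<in> borel_measurable M"
proof (rule borel_measurableI)
  fix U :: "real set" assume "open U"
  then have "L \<theta> -` {\<mu> \<in> prob_measures. (\<integral>x. V x \<partial>\<mu>) \<in> U} \<inter> space M \<in> events"
    using assms by (intro measurable_sets[OF L\<theta>] openin_sets_weak_borel weak_topology_openin_integral)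
  also have "L \<theta> -` {\<mu> \<in> prob_measures. (\<integral>x. V x \<partial>\<mu>) \<in> U} \<inter> space M = (\<lambda>\<omega>. \<integral>x. V x \<partial>L \<theta> \<omega>) -` U \<inter> space M"
    using L_prob by auto
  finally show "(\<lambda>\<omega>. \<integral>x. V x \<partial>L \<theta> \<omega>) -` U \<inter> space M \<in> events" .
qed

lemma L_event: "A \<in> sets weak_borel \<Longrightarrow> {\<omega> \<in> space M. L \<theta> \<omega> \<in> A} \<in> events"
  using measurable_sets[OF L\<theta>, of A] by (simp add: vimage_def Int_def conj_commute)

lemma L_indicator_measurable: "A \<in> sets weak_borel \<Longrightarrow> (\<lambda>\<omega>. indicator A (L \<theta> \<omega>) :: real) \<in> borel_measurable M"
  by (intro measurable_compose[OF L\<theta>] borel_measurable_indicator)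

lemma partition_integrable:
  assumes V: "V \<in> bcontfun" and A: "A \<in> sets weak_borel"
  shows "integrable M (\<lambda>\<omega>. exp (r \<theta> * (\<integral>x. V x \<partial>L \<theta> \<omega>)) * indicator A (L \<theta> \<omega>))"
proof -
  obtain B where B: "\<And>x. \<bar>V x\<bar> \<le> B" using bcontfun_boundE[OF V] by blast
  note [measurable] = L_integral_measurable[OF V] L_indicator_measurable[OF A]
  show ?thesis
  proof (rule integrable_const_bound[of _ "exp (r \<theta> * B)"])
    have "exp (r \<theta> * (\<integral>x. V x \<partial>L \<theta> \<omega>)) \<le> exp (r \<theta> * B)" if "\<omega> \<in> space M" for \<omega>
      using abs_integral_le[OF L_prob[OF that] B V] r\<theta> by (simp add: abs_le_iff)
    then show "AE \<omega> in M. norm (exp (r \<theta> * (\<integral>x. V x \<partial>L \<theta> \<omega>)) * indicator A (L \<theta> \<omega>)) \<le> exp (r \<theta> * B)"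
      by (intro AE_I2) (auto simp: indicator_def)
  qed measurable
qed

text \<open>The exponential Chebyshev inequality as a change of potential on \<open>A\<close>; with
  \<open>W = 0\<close> it bounds the moment by a probability.\<close>

lemma partition_fn_mono:
  assumes "V \<in> bcontfun" "W \<in> bcontfun" "A \<in> sets weak_borel" "B \<in> sets weak_borel"
    and "\<And>\<mu>. \<mu> \<in> A \<Longrightarrow> \<mu> \<in> B \<and> (\<integral>x. V x \<partial>\<mu>) \<le> c + (\<integral>x. W x \<partial>\<mu>)"
  shows "partition_fn V A \<theta> \<le> exp (r \<theta> * c) * partition_fn W B \<theta>"
proof -
  have "partition_fn V A \<theta> \<le> (\<integral>\<omega>. exp (r \<theta> * c) * (exp (r \<theta> * (\<integral>x. W x \<partial>L \<theta> \<omega>)) * indicator B (L \<theta> \<omega>)) \<partial>M)"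
    unfolding partition_fn_def
  proof (rule integral_mono)
    show "exp (r \<theta> * (\<integral>x. V x \<partial>L \<theta> \<omega>)) * indicator A (L \<theta> \<omega>)
        \<le> exp (r \<theta> * c) * (exp (r \<theta> * (\<integral>x. W x \<partial>L \<theta> \<omega>)) * indicator B (L \<theta> \<omega>))" for \<omega>
    proof (cases "L \<theta> \<omega> \<in> A")
      case True
      then have "r \<theta> * (\<integral>x. V x \<partial>L \<theta> \<omega>) \<le> r \<theta> * c + r \<theta> * (\<integral>x. W x \<partial>L \<theta> \<omega>)"
        using assms(5) r\<theta> by (simp flip: distrib_left)
      then have "exp (r \<theta> * (\<integral>x. V x \<partial>L \<theta> \<omega>)) \<le> exp (r \<theta> * c) * exp (r \<theta> * (\<integral>x. W x \<partial>L \<theta> \<omega>))"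
        by (simp flip: exp_add)
      then show ?thesis using True assms(5) by simp
    qed simp
  qed (intro partition_integrable integrable_mult_right assms)+
  then show ?thesis by (simp add: partition_fn_def)
qed

lemma partition_fn_subadd:
  assumes V: "V \<in> bcontfun" and m: "A \<in> sets weak_borel" "B \<in> sets weak_borel" "C \<in> sets weak_borel"
    and sub: "A \<subseteq> B \<union> C"
  shows "partition_fn V A \<theta> \<le> partition_fn V B \<theta> + partition_fn V C \<theta>"
proof -
  have "partition_fn V A \<theta> \<le> (\<integral>\<omega>. exp (r \<theta> * (\<integral>x. V x \<partial>L \<theta> \<omega>)) * indicator B (L \<theta> \<omega>) +
      exp (r \<theta> * (\<integral>x. V x \<partial>L \<theta> \<omega>)) * indicator C (L \<theta> \<omega>) \<partial>M)"
    unfolding partition_fn_def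
  proof (rule integral_mono)
    show "exp (r \<theta> * (\<integral>x. V x \<partial>L \<theta> \<omega>)) * indicator A (L \<theta> \<omega>)
      \<le> exp (r \<theta> * (\<integral>x. V x \<partial>L \<theta> \<omega>)) * indicator B (L \<theta> \<omega>) +
      exp (r \<theta> * (\<integral>x. V x \<partial>L \<theta> \<omega>)) * indicator C (L \<theta> \<omega>)" for \<omega>
      using sub by (auto simp: indicator_def)
  qed (intro partition_integrable Bochner_Integration.integrable_add V m)+
  then show ?thesis by (simp add: partition_fn_def partition_integrable V m)
qed

lemma partition_fn_subadd_UN:
  assumes V: "V \<in> bcontfun" and "finite J" and "\<And>j. j \<in> J \<Longrightarrow> B j \<in> sets weak_borel"
  shows "partition_fn V (\<Union>j\<in>J. B j) \<theta> \<le> (\<Sum>j\<in>J. partition_fn V (B j) \<theta>)"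
  using assms(2,3)
proof (induction J)
  case (insert j J)
  have "partition_fn V (\<Union>j\<in>insert j J. B j) \<theta> \<le> partition_fn V (B j) \<theta> + partition_fn V (\<Union>j\<in>J. B j) \<theta>"
    using insert by (intro partition_fn_subadd V) auto
  then show ?case using insert by auto
qed (simp add: partition_fn_def)

lemma partition_fn_0:
  assumes "A \<in> sets weak_borel"
  shows "partition_fn (\<lambda>_. 0) A \<theta> = measure M {\<omega> \<in> space M. L \<theta> \<omega> \<in> A}"
proof -
  have "partition_fn (\<lambda>_. 0) A \<theta> = (\<integral>\<omega>. indicator {\<omega> \<in> space M. L \<theta> \<omega> \<in> A} \<omega> \<partial>M)"
    unfolding partition_fn_def by (intro Bochner_Integration.integral_cong) (auto simp: indicator_def)
  then show ?thesis using L_event[OF assms] by simp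
qed

lemma partition_fn_le_measure:
  assumes V: "V \<in> bcontfun" and A: "A \<in> sets weak_borel" and c: "\<And>\<mu>. \<mu> \<in> A \<Longrightarrow> (\<integral>x. V x \<partial>\<mu>) \<le> c"
  shows "partition_fn V A \<theta> \<le> exp (r \<theta> * c) * measure M {\<omega> \<in> space M. L \<theta> \<omega> \<in> A}"
  using partition_fn_mono[OF V const_bcontfun[of 0] A A, of c] c by (simp add: partition_fn_0[OF A])

lemma partition_fn_UNIV:
  assumes "V \<in> bcontfun"
  shows "partition_fn V prob_measures \<theta> = (\<integral>\<omega>. exp (r \<theta> * (\<integral>x. V x \<partial>L \<theta> \<omega>)) \<partial>M)"
  unfolding partition_fn_def using L_prob by (intro Bochner_Integration.integral_cong) auto

end

lemma eventually_good: "\<forall>\<^sub>F \<theta> in N. L \<theta> \<in> measurable M weak_borel \<and> 0 < r \<theta>"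
  using L_ev eventually_r_gt[OF r, of 0] by (rule eventually_conj)

section \<open>Finiteness of the pressure and nonnegativity of its Legendre transform\<close>

abbreviation \<Lambda> :: "('a \<Rightarrow> real) \<Rightarrow> ereal" where "\<Lambda> \<equiv> pressure N M L r"
abbreviation I :: "'a measure \<Rightarrow> ereal" where "I \<equiv> legendre_rate N M L r"

lemma pressure_eq:
  assumes "V \<in> bcontfun"
  shows "\<Lambda> V = Limsup N (\<lambda>\<theta>. ereal (1 / r \<theta>) * elog (partition_fn V prob_measures \<theta>))"
  unfolding pressure_def scaled_log_mgf_def
  by (intro Limsup_eq eventually_mono[OF eventually_good]) (simp add: partition_fn_UNIV assms)

lemma exp_below_pressure:
  assumes "V \<in> bcontfun" "\<Lambda> V < ereal c"
  shows "exp_below N r (partition_fn V prob_measures) c"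
  using assms by (intro Limsup_less_imp_exp_below[OF r]) (simp add: pressure_eq)

lemma pressure_bounds:
  assumes V: "V \<in> bcontfun" and B: "\<And>x. \<bar>V x\<bar> \<le> B"
  shows "\<Lambda> V \<le> ereal B" "ereal (- B) \<le> \<Lambda> V"
proof -
  have m1: "measure M {\<omega> \<in> space M. L \<theta> \<omega> \<in> prob_measures} = 1" if "L \<theta> \<in> measurable M weak_borel" for \<theta>
  proof -
    have "{\<omega> \<in> space M. L \<theta> \<omega> \<in> prob_measures} = space M"
      using measurable_space[OF that] by (auto simp: space_weak_borel)
    then show ?thesis by (simp add: prob_space)
  qed
  have V_le: "(\<integral>x. V x \<partial>\<mu>) \<le> B" "- B \<le> (\<integral>x. V x \<partial>\<mu>)" if "\<mu> \<in> prob_measures" for \<mu>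
    using abs_integral_le[OF that B V] by linarith+
  have "\<forall>\<^sub>F \<theta> in N. ereal (1 / r \<theta>) * elog (partition_fn V prob_measures \<theta>) \<le> ereal B"
    using eventually_good
  proof eventually_elim
    case (elim \<theta>)
    then show ?case using partition_fn_le_measure[of \<theta> V prob_measures B] V V_le m1[of \<theta>]
      by (simp add: scaled_elog_le_iff)
  qed
  then show "\<Lambda> V \<le> ereal B" unfolding pressure_eq[OF V] by (rule Limsup_bounded)
  have "\<forall>\<^sub>F \<theta> in N. ereal (- B) \<le> ereal (1 / r \<theta>) * elog (partition_fn V prob_measures \<theta>)"
    using eventually_good
  proof eventually_elim
    case (elim \<theta>)
    have "partition_fn (\<lambda>_. 0) prob_measures \<theta> \<le> exp (r \<theta> * B) * partition_fn V prob_measures \<theta>"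
    proof (intro partition_fn_mono const_bcontfun)
      show "\<mu> \<in> prob_measures \<and> (\<integral>x. 0 \<partial>\<mu>) \<le> B + (\<integral>x. V x \<partial>\<mu>)" if "\<mu> \<in> prob_measures" for \<mu>
        using V_le(2)[OF that] that by simp
    qed (use elim V in auto)
    then have "exp (r \<theta> * (- B)) \<le> partition_fn V prob_measures \<theta>"
      using elim m1[of \<theta>] by (simp add: partition_fn_0 exp_minus field_simps)
    also have "\<dots> \<le> exp (ln (partition_fn V prob_measures \<theta>))"
      using calculation exp_gt_zero[of "r \<theta> * (- B)"] by (subst exp_ln) linarith+
    finally have "r \<theta> * (- B) \<le> ln (partition_fn V prob_measures \<theta>)" by simp
    moreover have "0 < partition_fn V prob_measures \<theta>"
      using \<open>exp (r \<theta> * (- B)) \<le> partition_fn V prob_measures \<theta>\<close> exp_gt_zero[of "r \<theta> * (- B)"] by linarith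
    ultimately show ?case using elim by (simp add: elog_def field_simps)
  qed
  \<comment> \<open>The filter is proper, so a lower bound that holds eventually also bounds the
    upper limit from below.\<close>
  then show "ereal (- B) \<le> \<Lambda> V" unfolding pressure_eq[OF V]
    by (rule order_trans[OF Liminf_bounded Liminf_le_Limsup[OF N]])
qed

text \<open>With a finite pressure, differences such as
  \<open>ereal (\<integral>x. V x \<partial>\<sigma>) - \<Lambda> V\<close> become real
  arithmetic.\<close>

lemma pressure_finite:
  assumes V: "V \<in> bcontfun"
  obtains c where "\<Lambda> V = ereal c"
proof -
  obtain B where "\<And>x. \<bar>V x\<bar> \<le> B" using bcontfun_boundE[OF V] by blast
  from pressure_bounds[OF V this] show ?thesis using that by (cases "\<Lambda> V") auto
qed

lemma legendre_rate_ge: "V \<in> bcontfun \<Longrightarrow> ereal (\<integral>x. V x \<partial>\<sigma>) - \<Lambda> V \<le> I \<sigma>"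
  unfolding legendre_rate_def by (rule SUP_upper)

lemma legendre_rate_nonneg: "0 \<le> I \<sigma>"
proof -
  obtain v where v: "\<Lambda> (\<lambda>_. 0) = ereal v" using pressure_finite[OF const_bcontfun] .
  have "\<Lambda> (\<lambda>_. 0) \<le> 0" using pressure_bounds(1)[of "\<lambda>_. 0" 0] const_bcontfun[of "0::real"] by (simp add: zero_ereal_def)
  moreover have "ereal (\<integral>x. 0 \<partial>\<sigma>) - \<Lambda> (\<lambda>_. 0) \<le> I \<sigma>" by (intro legendre_rate_ge const_bcontfun)
  ultimately have "0 \<le> ereal (- v)" "ereal (- v) \<le> I \<sigma>" by (simp_all add: v)
  then show ?thesis by (rule order_trans)
qed

text \<open>Tilting by \<open>V\<close>: every \<open>\<sigma>\<close> in \<open>F\<close> is separated by a competing potential \<open>W\<close>, whose half space is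
  controlled by the exponential Chebyshev inequality; finitely many half spaces cover the compact
  part of \<open>F\<close>.\<close>

lemma partition_fn_closed_exp_below:
  assumes V: "V \<in> bcontfun" and F: "closedin weak_topology F"
    and sep: "\<And>\<sigma>. \<sigma> \<in> F \<Longrightarrow> ereal ((\<integral>x. V x \<partial>\<sigma>) - c) < I \<sigma>"
  shows "exp_below N r (partition_fn V F) c"
proof -
  have FP: "F \<subseteq> prob_measures" using closedin_subset[OF F] by simp
  have oF: "openin weak_topology (prob_measures - F)" using F by (simp add: closedin_def)
  have Fs: "F \<in> sets weak_borel" by (rule closedin_sets_weak_borel[OF F])
  have "\<exists>W a. W \<in> bcontfun \<and> \<Lambda> W < ereal (a + c) \<and> a < (\<integral>x. W x - V x \<partial>\<sigma>)" if \<sigma>: "\<sigma> \<in> F" for \<sigma>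
  proof -
    obtain W where W: "W \<in> bcontfun" "ereal ((\<integral>x. V x \<partial>\<sigma>) - c) < ereal (\<integral>x. W x \<partial>\<sigma>) - \<Lambda> W"
      using sep[OF \<sigma>] by (auto simp: legendre_rate_def less_SUP_iff)
    obtain w where w: "\<Lambda> W = ereal w" using pressure_finite[OF W(1)] .
    have "w - c < (\<integral>x. W x \<partial>\<sigma>) - (\<integral>x. V x \<partial>\<sigma>)" using W(2) by (simp add: w)
    moreover have "(\<integral>x. W x - V x \<partial>\<sigma>) = (\<integral>x. W x \<partial>\<sigma>) - (\<integral>x. V x \<partial>\<sigma>)"
      using FP \<sigma> by (intro Bochner_Integration.integral_diff integrable_bcontfun W V) auto
    \<comment> \<open>Room is left on both sides: the lower inequality is the pressure bound
      \<open>\<Lambda> W < a + c\<close>, and the upper one puts \<open>\<sigma>\<close> into an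
      open half space.\<close>
    ultimately obtain a where "w - c < a" "a < (\<integral>x. W x - V x \<partial>\<sigma>)" using dense by metis
    then show ?thesis using W(1) w by (intro exI[of _ W] exI[of _ a]) auto
  qed
  then obtain W a where W: "\<And>\<sigma>. \<sigma> \<in> F \<Longrightarrow> W \<sigma> \<in> bcontfun"
    and Wp: "\<And>\<sigma>. \<sigma> \<in> F \<Longrightarrow> \<Lambda> (W \<sigma>) < ereal (a \<sigma> + c)"
    and Wa: "\<And>\<sigma>. \<sigma> \<in> F \<Longrightarrow> a \<sigma> < (\<integral>x. W \<sigma> x - V x \<partial>\<sigma>)"
    by metis
  define U where "U \<sigma> = {\<mu> \<in> prob_measures. (\<integral>x. W \<sigma> x - V x \<partial>\<mu>) \<in> {a \<sigma><..}}" for \<sigma>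
  have oU: "openin weak_topology (U \<sigma>)" if "\<sigma> \<in> F" for \<sigma>
    unfolding U_def by (intro weak_topology_openin_integral minus_cont W V that open_greaterThan)
  \<comment> \<open>On \<open>U \<sigma>\<close> the integral of \<open>W \<sigma>\<close> exceeds
    that of \<open>V\<close> by at least \<open>a \<sigma>\<close>, so the growth rate is at most
    \<open>\<Lambda> (W \<sigma>) - a \<sigma>\<close>, which is below \<open>c\<close>.\<close>
  have Ub: "exp_below N r (partition_fn V (U \<sigma>)) c" if \<sigma>: "\<sigma> \<in> F" for \<sigma>
  proof (rule exp_below_mono)
    show "exp_below N r (\<lambda>\<theta>. exp (r \<theta> * (- a \<sigma>)) * partition_fn (W \<sigma>) prob_measures \<theta>) c"
      using exp_below_scale[OF exp_below_pressure[OF W[OF \<sigma>] Wp[OF \<sigma>]], of "- a \<sigma>"] by simp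
    show "\<forall>\<^sub>F \<theta> in N. partition_fn V (U \<sigma>) \<theta> \<le> exp (r \<theta> * (- a \<sigma>)) * partition_fn (W \<sigma>) prob_measures \<theta>"
      using eventually_good
    proof eventually_elim
      case (elim \<theta>)
      have "\<mu> \<in> prob_measures \<and> (\<integral>x. V x \<partial>\<mu>) \<le> - a \<sigma> + (\<integral>x. W \<sigma> x \<partial>\<mu>)" if "\<mu> \<in> U \<sigma>" for \<mu>
        using that integrable_bcontfun[OF _ V, of \<mu>] integrable_bcontfun[OF _ W[OF \<sigma>], of \<mu>] by (auto simp: U_def)
      then show ?case using elim
        by (intro partition_fn_mono V W[OF \<sigma>] openin_sets_weak_borel[OF oU[OF \<sigma>]]) auto
    qed
  qed
  obtain B where B: "0 \<le> B" "\<And>x. \<bar>V x\<bar> \<le> B" using bcontfun_boundE[OF V] by blast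
  \<comment> \<open>Bounding \<open>V\<close> by \<open>B\<close> far from \<open>K\<close> costs
    the factor \<open>exp (r \<theta> * B)\<close>; as \<open>l > B - c\<close>, the remaining rate
    \<open>B - l\<close> is still below \<open>c\<close>.\<close>
  define l where "l = max 1 (B - c + 1)"
  have l: "0 < l" by (simp add: l_def)
  obtain K where K: "compactin weak_topology K"
    and KL: "\<And>\<epsilon>. \<epsilon> > 0 \<Longrightarrow> Limsup N (\<lambda>\<theta>. ereal (1 / r \<theta>) *
                elog (measure M {\<omega> \<in> space M. L \<theta> \<omega> \<in> prob_measures - prob_nhd K \<epsilon>})) \<le> ereal (- l)"
    using AET[of l] l by blast
  have KP: "K \<subseteq> prob_measures" using compactin_subset_topspace[OF K] by simp
  have "compactin weak_topology (F \<inter> K)" by (rule closed_Int_compactin[OF F K])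
  moreover have "F \<inter> K \<subseteq> \<Union>(U ` F)" using Wa FP by (auto simp: U_def)
  ultimately obtain \<F> where "finite \<F>" "\<F> \<subseteq> U ` F" "F \<inter> K \<subseteq> \<Union>\<F>"
    using compactinD[of weak_topology "F \<inter> K" "U ` F"] oU by blast
  then obtain J where J: "finite J" "J \<subseteq> F" "F \<inter> K \<subseteq> (\<Union>\<sigma>\<in>J. U \<sigma>)"
    by (metis finite_subset_image)
  have oUJ: "openin weak_topology (\<Union>\<sigma>\<in>J. U \<sigma>)" using oU J by (intro openin_Union) auto
  \<comment> \<open>The half spaces cover only \<open>F \<inter> K\<close>. Adding the open
    complement of \<open>F\<close> covers \<open>K\<close>, hence a neighbourhood of it, so what the
    half spaces miss of \<open>F\<close> lies outside that neighbourhood.\<close>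
  have "openin weak_topology ((prob_measures - F) \<union> (\<Union>\<sigma>\<in>J. U \<sigma>))" by (rule openin_Un[OF oF oUJ])
  moreover have "K \<subseteq> (prob_measures - F) \<union> (\<Union>\<sigma>\<in>J. U \<sigma>)" using J KP by blast
  ultimately obtain \<epsilon> where \<epsilon>: "\<epsilon> > 0" "prob_nhd K \<epsilon> \<subseteq> (prob_measures - F) \<union> (\<Union>\<sigma>\<in>J. U \<sigma>)"
    using compact_prob_nhd_subset[OF K] by metis
  define R where "R = prob_measures - prob_nhd K \<epsilon>"
  have R: "R \<in> sets weak_borel"
    unfolding R_def using openin_sets_weak_borel[OF openin_prob_nhd[OF KP]] by (intro sets.Diff) auto
  have "- l < c - B" by (simp add: l_def)
  then have "Limsup N (\<lambda>\<theta>. ereal (1 / r \<theta>) * elog (measure M {\<omega> \<in> space M. L \<theta> \<omega> \<in> R})) < ereal (c - B)"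
    using KL[OF \<epsilon>(1)] unfolding R_def by (intro order.strict_trans1[OF _ less_ereal.simps(1)[THEN iffD2]])
  then have "exp_below N r (\<lambda>\<theta>. measure M {\<omega> \<in> space M. L \<theta> \<omega> \<in> R}) (c - B)"
    by (rule Limsup_less_imp_exp_below[OF r])
  from exp_below_scale[OF this, of B]
  have "exp_below N r (\<lambda>\<theta>. exp (r \<theta> * B) * measure M {\<omega> \<in> space M. L \<theta> \<omega> \<in> R}) c" by simp
  moreover have "exp_below N r (\<lambda>\<theta>. \<Sum>\<sigma>\<in>J. partition_fn V (U \<sigma>) \<theta>) c"
    using J Ub by (intro exp_below_sum[OF r]) auto
  ultimately have "exp_below N r (\<lambda>\<theta>. (\<Sum>\<sigma>\<in>J. partition_fn V (U \<sigma>) \<theta>) +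
      exp (r \<theta> * B) * measure M {\<omega> \<in> space M. L \<theta> \<omega> \<in> R}) c"
    by (rule exp_below_add[OF r, rotated])
  then show ?thesis
  proof (rule exp_below_mono)
    show "\<forall>\<^sub>F \<theta> in N. partition_fn V F \<theta> \<le> (\<Sum>\<sigma>\<in>J. partition_fn V (U \<sigma>) \<theta>) +
      exp (r \<theta> * B) * measure M {\<omega> \<in> space M. L \<theta> \<omega> \<in> R}"
      using eventually_good
    proof eventually_elim
      case (elim \<theta>)
      then have L\<theta>: "L \<theta> \<in> measurable M weak_borel" "0 < r \<theta>" by auto
      have "F \<subseteq> (\<Union>\<sigma>\<in>J. U \<sigma>) \<union> R" using \<epsilon>(2) FP by (auto simp: R_def)
      then have "partition_fn V F \<theta> \<le> partition_fn V (\<Union>\<sigma>\<in>J. U \<sigma>) \<theta> + partition_fn V R \<theta>"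
        by (intro partition_fn_subadd L\<theta> V Fs R openin_sets_weak_borel oUJ)
      also have "partition_fn V (\<Union>\<sigma>\<in>J. U \<sigma>) \<theta> \<le> (\<Sum>\<sigma>\<in>J. partition_fn V (U \<sigma>) \<theta>)"
        using J oU by (intro partition_fn_subadd_UN L\<theta> V openin_sets_weak_borel) auto
      also have "partition_fn V R \<theta> \<le> exp (r \<theta> * B) * measure M {\<omega> \<in> space M. L \<theta> \<omega> \<in> R}"
      proof (rule partition_fn_le_measure[OF L\<theta> V R])
        fix \<mu> assume "\<mu> \<in> R"
        then have "\<mu> \<in> prob_measures" by (simp add: R_def)
        then show "(\<integral>x. V x \<partial>\<mu>) \<le> B" using abs_integral_le[OF _ B(2) V] by fastforce
      qed
      finally show ?case by simp
    qed
  qed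
qed

section \<open>The upper bound for closed sets\<close>

lemma ldp_upper_bound:
  assumes F: "closedin weak_topology F"
  shows "Limsup N (\<lambda>\<theta>. ereal (1 / r \<theta>) * elog (measure M {\<omega> \<in> space M. L \<theta> \<omega> \<in> F})) \<le> - (INF \<sigma>\<in>F. I \<sigma>)"
    (is "?Ls \<le> _")
proof -
  have "?Ls \<le> ereal (- a)" if a: "ereal a < (INF \<sigma>\<in>F. I \<sigma>)" for a
  proof -
    \<comment> \<open>With potential 0 and \<open>c = - a\<close>, the separation hypothesis says
      that \<open>I\<close> exceeds \<open>a\<close> on \<open>F\<close>.\<close>
    have "exp_below N r (partition_fn (\<lambda>_. 0) F) (- a)"
    proof (rule partition_fn_closed_exp_below[OF const_bcontfun F])
      fix \<sigma> assume "\<sigma> \<in> F"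
      then show "ereal ((\<integral>x. 0 \<partial>\<sigma>) - - a) < I \<sigma>" using a by (auto dest: less_INF_D)
    qed
    then have "exp_below N r (\<lambda>\<theta>. measure M {\<omega> \<in> space M. L \<theta> \<omega> \<in> F}) (- a)"
      by (rule exp_below_mono)
        (auto intro!: eventually_mono[OF eventually_good] simp: partition_fn_0 closedin_sets_weak_borel[OF F])
    then show ?thesis by (rule exp_below_imp_Limsup_le[OF r])
  qed
  note bound = this
  \<comment> \<open>Real \<open>a\<close> below the infimum suffice, even if it is infinite: a
    violation would leave a real \<open>z\<close> strictly between the two sides.\<close>
  show ?thesis
  proof (rule ccontr)
    assume "\<not> ?thesis"
    then obtain z where z: "- (INF \<sigma>\<in>F. I \<sigma>) < ereal z" "ereal z < ?Ls"
      using ereal_dense2[of "- (INF \<sigma>\<in>F. I \<sigma>)" ?Ls] by (auto simp: not_le)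
    then have "ereal (- z) < (INF \<sigma>\<in>F. I \<sigma>)" by (simp add: ereal_uminus_less_reorder flip: uminus_ereal.simps(1))
    from bound[OF this] z(2) show False by simp
  qed
qed

section \<open>Compactness of the sublevel sets of the rate function\<close>

lemma legendre_rate_tight:
  assumes x: "\<And>y e. 0 < e \<Longrightarrow> \<exists>i. dist y (x i) < e" and \<delta>: "0 < \<delta>" and \<eta>: "0 < \<eta>"
  shows "\<exists>n. \<forall>\<sigma>\<in>{\<sigma> \<in> prob_measures. I \<sigma> \<le> ereal a}. 1 - \<eta> \<le> (\<integral>y. bump_max x \<delta> n y \<partial>\<sigma>)"
proof -
  \<comment> \<open>\<open>l\<close> is so large that \<open>a \<le> l * \<eta> / 2\<close>; the
    other half of \<open>l * \<eta>\<close> is reserved for the pressure of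
    \<open>V\<close>.\<close>
  define l where "l = max 1 (2 * \<bar>a\<bar> / \<eta>)"
  have l: "1 \<le> l" by (simp add: l_def)
  have "2 * \<bar>a\<bar> / \<eta> \<le> l" by (simp add: l_def)
  then have al: "2 * a \<le> l * \<eta>" using \<eta> by (simp add: pos_divide_le_eq)
  obtain K where K: "compactin weak_topology K"
    and KL: "\<And>\<epsilon>. \<epsilon> > 0 \<Longrightarrow> Limsup N (\<lambda>\<theta>. ereal (1 / r \<theta>) *
                elog (measure M {\<omega> \<in> space M. L \<theta> \<omega> \<in> prob_measures - prob_nhd K \<epsilon>})) \<le> ereal (- l)"
    using AET[of l] l by auto
  have KP: "K \<subseteq> prob_measures" using compactin_subset_topspace[OF K] by simp
  define h where "h = bump_max x \<delta>"
  have h: "h n \<in> bcontfun" for n unfolding h_def by (rule bump_max_bcontfun[OF \<delta>])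
  define U where "U n = {\<mu> \<in> prob_measures. (\<integral>y. h n y \<partial>\<mu>) \<in> {1 - \<eta> / 4<..}}" for n
  have oU: "openin weak_topology (U n)" for n
    unfolding U_def by (intro weak_topology_openin_integral h open_greaterThan)
  have U_mono: "U m \<subseteq> U n" if "m \<le> n" for m n
  proof
    fix \<mu> assume \<mu>: "\<mu> \<in> U m"
    have "(\<integral>y. h m y \<partial>\<mu>) \<le> (\<integral>y. h n y \<partial>\<mu>)"
      using \<mu> bump_max_mono[OF that] by (intro integral_mono integrable_bcontfun h) (auto simp: U_def h_def)
    then show "\<mu> \<in> U n" using \<mu> by (auto simp: U_def)
  qed
  have "K \<subseteq> \<Union>(range U)"
  proof
    fix \<mu> assume "\<mu> \<in> K"
    then have \<mu>: "\<mu> \<in> prob_measures" using KP by blast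
    have "\<forall>\<^sub>F n in sequentially. 1 - \<eta> / 4 < (\<integral>y. h n y \<partial>\<mu>)"
      unfolding h_def by (rule order_tendstoD(1)[OF bump_max_integral_tendsto[OF x \<mu> \<delta>]]) (use \<eta> in simp_all)
    then show "\<mu> \<in> \<Union>(range U)" using \<mu> by (auto simp: U_def eventually_sequentially)
  qed
  then obtain \<F> where "finite \<F>" "\<F> \<subseteq> range U" "K \<subseteq> \<Union>\<F>"
    using compactinD[OF K, of "range U"] oU by blast
  then obtain J where J: "finite J" "K \<subseteq> (\<Union>n\<in>J. U n)" by (metis finite_subset_image)
  \<comment> \<open>The sets \<open>U n\<close> increase, so the largest index suffices; inserting 0
    keeps the maximum defined for empty \<open>J\<close>.\<close>
  define n where "n = Max (insert 0 J)"
  have "U j \<subseteq> U n" if "j \<in> J" for j using J(1) that by (intro U_mono) (simp add: n_def)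
  then have "K \<subseteq> U n" using J(2) by blast
  then obtain \<epsilon> where \<epsilon>: "\<epsilon> > 0" "prob_nhd K \<epsilon> \<subseteq> U n" using compact_prob_nhd_subset[OF K oU] by metis
  define R where "R = prob_measures - prob_nhd K \<epsilon>"
  have R: "R \<in> sets weak_borel"
    unfolding R_def using openin_sets_weak_borel[OF openin_prob_nhd[OF KP]] by (intro sets.Diff) auto
  \<comment> \<open>\<open>V\<close> penalises mass away from the chosen balls. Its integral is at
    most \<open>l * \<eta> / 4\<close> on \<open>U n\<close> and at most \<open>l\<close> on
    \<open>R\<close>, whose probability decays at rate at least \<open>l\<close>; hence its pressure
    is at most \<open>l * \<eta> / 2\<close>.\<close>
  define V where "V y = l * (1 - h n y)" for y
  have V: "V \<in> bcontfun"
    using scaleR_cont[OF minus_cont[OF const_bcontfun[of 1] h[of n]], of l] by (simp add: V_def[abs_def])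
  have Vint: "(\<integral>y. V y \<partial>\<mu>) = l * (1 - (\<integral>y. h n y \<partial>\<mu>))" if \<mu>: "\<mu> \<in> prob_measures" for \<mu>
    using integrable_bcontfun[OF \<mu> h[of n]] prob_space.prob_space[OF prob_measuresD(1)[OF \<mu>]]
      prob_space.finite_measure[OF prob_measuresD(1)[OF \<mu>]]
    by (simp add: V_def finite_measure.integrable_const)
  have "- l < l * \<eta> / 2 - l" using l \<eta> by simp
  then have "Limsup N (\<lambda>\<theta>. ereal (1 / r \<theta>) * elog (measure M {\<omega> \<in> space M. L \<theta> \<omega> \<in> R})) < ereal (l * \<eta> / 2 - l)"
    using KL[OF \<epsilon>(1)] unfolding R_def by (intro order.strict_trans1[OF _ less_ereal.simps(1)[THEN iffD2]])
  then have "exp_below N r (\<lambda>\<theta>. measure M {\<omega> \<in> space M. L \<theta> \<omega> \<in> R}) (l * \<eta> / 2 - l)"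
    by (rule Limsup_less_imp_exp_below[OF r])
  from exp_below_scale[OF this, of l]
  have "exp_below N r (\<lambda>\<theta>. exp (r \<theta> * l) * measure M {\<omega> \<in> space M. L \<theta> \<omega> \<in> R}) (l * \<eta> / 2)" by simp
  moreover have "exp_below N r (\<lambda>\<theta>. exp (r \<theta> * (l * \<eta> / 4))) (l * \<eta> / 2)"
    using mult_pos_pos[of l \<eta>] l \<eta> by (intro exp_below_exp) simp
  ultimately have "exp_below N r (\<lambda>\<theta>. exp (r \<theta> * (l * \<eta> / 4)) +
      exp (r \<theta> * l) * measure M {\<omega> \<in> space M. L \<theta> \<omega> \<in> R}) (l * \<eta> / 2)"
    by (rule exp_below_add[OF r, rotated])
  then have "exp_below N r (partition_fn V prob_measures) (l * \<eta> / 2)"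
  proof (rule exp_below_mono)
    show "\<forall>\<^sub>F \<theta> in N. partition_fn V prob_measures \<theta> \<le> exp (r \<theta> * (l * \<eta> / 4)) +
      exp (r \<theta> * l) * measure M {\<omega> \<in> space M. L \<theta> \<omega> \<in> R}"
      using eventually_good
    proof eventually_elim
      case (elim \<theta>)
      then have L\<theta>: "L \<theta> \<in> measurable M weak_borel" "0 < r \<theta>" by auto
      have Us: "U n \<in> sets weak_borel" by (rule openin_sets_weak_borel[OF oU])
      have "partition_fn V prob_measures \<theta> \<le> partition_fn V (U n) \<theta> + partition_fn V R \<theta>"
        using \<epsilon>(2) by (intro partition_fn_subadd L\<theta> V R Us) (auto simp: R_def)
      also have "partition_fn V (U n) \<theta> \<le> exp (r \<theta> * (l * \<eta> / 4)) * measure M {\<omega> \<in> space M. L \<theta> \<omega> \<in> U n}"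
      proof (rule partition_fn_le_measure[OF L\<theta> V Us])
        fix \<mu> assume "\<mu> \<in> U n"
        then have "\<mu> \<in> prob_measures" "1 - (\<integral>y. h n y \<partial>\<mu>) \<le> \<eta> / 4" by (auto simp: U_def)
        then show "(\<integral>y. V y \<partial>\<mu>) \<le> l * \<eta> / 4"
          using mult_left_mono[of "1 - (\<integral>y. h n y \<partial>\<mu>)" "\<eta> / 4" l] l by (simp add: Vint)
      qed
      also have "\<dots> \<le> exp (r \<theta> * (l * \<eta> / 4))" by (simp add: mult_left_le)
      also have "partition_fn V R \<theta> \<le> exp (r \<theta> * l) * measure M {\<omega> \<in> space M. L \<theta> \<omega> \<in> R}"
      proof (rule partition_fn_le_measure[OF L\<theta> V R])
        fix \<mu> assume "\<mu> \<in> R"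
        then have \<mu>: "\<mu> \<in> prob_measures" by (simp add: R_def)
        have "0 \<le> (\<integral>y. h n y \<partial>\<mu>)" by (intro integral_nonneg_AE) (simp add: h_def bump_max_bounds)
        then show "(\<integral>y. V y \<partial>\<mu>) \<le> l" using l by (simp add: Vint[OF \<mu>] mult_left_le)
      qed
      finally show ?case by simp
    qed
  qed
  then have PV: "\<Lambda> V \<le> ereal (l * \<eta> / 2)"
    unfolding pressure_eq[OF V] by (rule exp_below_imp_Limsup_le[OF r])
  have "1 - \<eta> \<le> (\<integral>y. h n y \<partial>\<sigma>)" if \<sigma>: "\<sigma> \<in> prob_measures" "I \<sigma> \<le> ereal a" for \<sigma>
  proof -
    obtain v where v: "\<Lambda> V = ereal v" using pressure_finite[OF V] .
    have "ereal (\<integral>y. V y \<partial>\<sigma>) - \<Lambda> V \<le> ereal a" using legendre_rate_ge[OF V] \<sigma>(2) by (rule order_trans)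
    then have "l * (1 - (\<integral>y. h n y \<partial>\<sigma>)) \<le> a + l * \<eta> / 2"
      using PV by (simp add: v Vint[OF \<sigma>(1)])
    also have "\<dots> \<le> l * \<eta>" using al by simp
    finally show ?thesis using l by simp
  qed
  then show ?thesis by (auto simp: h_def)
qed

lemma good_rate_function_legendre: "good_rate_function weak_topology I"
proof -
  have cl: "closedin weak_topology {\<sigma> \<in> prob_measures. I \<sigma> \<le> ereal a}" for a
  proof -
    \<comment> \<open>A supremum of weakly continuous functions of \<open>\<sigma>\<close> has as
      sublevel sets intersections of closed half spaces; the real conversion of
      \<open>\<Lambda> V\<close> is faithful because the pressure is finite.\<close>
    have eq: "{\<sigma> \<in> prob_measures. I \<sigma> \<le> ereal a} =
        (\<Inter>V\<in>bcontfun. {\<sigma> \<in> prob_measures. (\<integral>x. V x \<partial>\<sigma>) \<in> {..a + real_of_ereal (\<Lambda> V)}})"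
    proof -
      have "ereal (\<integral>x. V x \<partial>\<sigma>) - \<Lambda> V \<le> ereal a \<longleftrightarrow> (\<integral>x. V x \<partial>\<sigma>) \<le> a + real_of_ereal (\<Lambda> V)"
        if V: "V \<in> bcontfun" for V and \<sigma> :: "'a measure"
        by (rule pressure_finite[OF V]) auto
      then show ?thesis using const_bcontfun[of "0::real"]
        by (auto simp: legendre_rate_def SUP_le_iff)
    qed
    show ?thesis unfolding eq
    proof (rule closedin_Inter)
      show "(\<lambda>V. {\<sigma> \<in> prob_measures. (\<integral>x. V x \<partial>\<sigma>) \<in> {..a + real_of_ereal (\<Lambda> V)}}) ` bcontfun \<noteq> {}"
        using const_bcontfun[of "0::real"] by auto
      fix S assume "S \<in> (\<lambda>V. {\<sigma> \<in> prob_measures. (\<integral>x. V x \<partial>\<sigma>) \<in> {..a + real_of_ereal (\<Lambda> V)}}) ` bcontfun"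
      then obtain V where V: "V \<in> bcontfun"
        and S: "S = {\<sigma> \<in> prob_measures. (\<integral>x. V x \<partial>\<sigma>) \<in> {..a + real_of_ereal (\<Lambda> V)}}" by blast
      show "closedin weak_topology S"
        unfolding S using closedin_continuous_map_preimage[OF continuous_map_weak_integral[OF V], of "{..a + real_of_ereal (\<Lambda> V)}"]
        by simp
    qed
  qed
  obtain x :: "nat \<Rightarrow> 'a" where x: "\<And>y e. 0 < e \<Longrightarrow> \<exists>i. dist y (x i) < e"
    by (rule dense_sequence_exists) blast
  have "compactin weak_topology {\<sigma> \<in> prob_measures. I \<sigma> \<le> ereal a}" for a
    by (rule compactin_weak_topology_tight[OF x cl legendre_rate_tight[OF x]])
  then show ?thesis using cl legendre_rate_nonneg by (simp add: good_rate_function_def rate_function_def)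
qed

section \<open>The lower bound for open sets\<close>

lemma ldp_lower_bound_at:
  assumes adm: "V \<in> admissible_potentials N M L r" and eq: "equilibrium_state N M L r V \<sigma>"
    and G: "openin weak_topology G" and \<sigma>G: "\<sigma> \<in> G"
  shows "- I \<sigma> \<le> Liminf N (\<lambda>\<theta>. ereal (1 / r \<theta>) * elog (measure M {\<omega> \<in> space M. L \<theta> \<omega> \<in> G}))"
proof -
  have V: "V \<in> bcontfun" and lim: "(scaled_log_mgf M L r V \<longlongrightarrow> \<Lambda> V) N"
    and uniq: "\<And>\<sigma>'. equilibrium_state N M L r V \<sigma>' \<Longrightarrow> \<sigma>' = \<sigma>"
    using adm eq by (auto simp: admissible_potentials_def bounded_lipschitz_bcontfun)
  obtain v where v: "\<Lambda> V = ereal v" using pressure_finite[OF V] .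
  define s where "s = (\<integral>x. V x \<partial>\<sigma>)"
  have \<sigma>: "\<sigma> \<in> prob_measures" and "\<Lambda> V = ereal s - I \<sigma>" using eq by (auto simp: equilibrium_state_def s_def)
  then have Is: "I \<sigma> = ereal (s - v)" using v by (cases "I \<sigma>") auto
  have "ereal (v - s) \<le> Liminf N (\<lambda>\<theta>. ereal (1 / r \<theta>) * elog (measure M {\<omega> \<in> space M. L \<theta> \<omega> \<in> G}))"
  proof (rule Liminf_geI[OF r])
    fix c assume c: "c < v - s"
    \<comment> \<open>A quarter of the slack: one \<open>\<delta>\<close> pays for the variation of
      \<open>V\<close> on \<open>G'\<close>, one for a factor 2, one for the loss from
      \<open>v\<close> to \<open>c1\<close>.\<close>
    define \<delta> where "\<delta> = (v - s - c) / 4"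
    have \<delta>: "\<delta> > 0" using c by (simp add: \<delta>_def)
    define G' where "G' = G \<inter> {\<mu> \<in> prob_measures. (\<integral>x. V x \<partial>\<mu>) \<in> {..<s + \<delta>}}"
    have G': "openin weak_topology G'"
      unfolding G'_def by (intro openin_Int G weak_topology_openin_integral V open_lessThan)
    have GP: "G' \<subseteq> prob_measures" by (auto simp: G'_def)
    have \<sigma>G': "\<sigma> \<in> G'" using \<sigma> \<sigma>G \<delta> by (simp add: G'_def s_def)
    have F': "closedin weak_topology (prob_measures - G')" using G' openin_closedin_eq[of weak_topology G'] by auto
    have "exp_below N r (partition_fn V (prob_measures - G')) v"
    proof (rule partition_fn_closed_exp_below[OF V F'])
      fix \<kappa> assume \<kappa>: "\<kappa> \<in> prob_measures - G'"
      \<comment> \<open>The Legendre inequality holds for every measure, with equality exactly at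
        equilibrium states; uniqueness makes it strict off \<open>G'\<close>.\<close>
      then have "\<not> equilibrium_state N M L r V \<kappa>" using uniq \<sigma>G' by blast
      then have "ereal v \<noteq> ereal (\<integral>x. V x \<partial>\<kappa>) - I \<kappa>" using \<kappa> v by (auto simp: equilibrium_state_def)
      moreover have "ereal (\<integral>x. V x \<partial>\<kappa>) - ereal v \<le> I \<kappa>" using legendre_rate_ge[OF V, of \<kappa>] v by simp
      ultimately show "ereal ((\<integral>x. V x \<partial>\<kappa>) - v) < I \<kappa>" by (cases "I \<kappa>") auto
    qed
    then obtain c0 where c0: "c0 < v" "\<forall>\<^sub>F \<theta> in N. partition_fn V (prob_measures - G') \<theta> \<le> exp (r \<theta> * c0)"
      by (auto simp: exp_below_def)
    \<comment> \<open>\<open>c1\<close> lies below \<open>v\<close>, so the full moment eventually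
      exceeds \<open>exp (r \<theta> * c1)\<close>, and above \<open>c0\<close>, so the contribution
      off \<open>G'\<close> is negligible against that.\<close>
    define c1 where "c1 = max (v - \<delta>) ((v + c0) / 2)"
    have c1: "c1 < v" "c0 < c1" "v - \<delta> \<le> c1" using c0(1) \<delta> by (simp_all add: c1_def less_max_iff_disj)
    \<comment> \<open>Here the pressure must be a limit: an upper limit would give this bound only
      frequently.\<close>
    have "\<forall>\<^sub>F \<theta> in N. ereal c1 < scaled_log_mgf M L r V \<theta>"
      by (rule order_tendstoD(1)[OF lim]) (simp add: v c1)
    then show "\<forall>\<^sub>F \<theta> in N. exp (r \<theta> * c) < measure M {\<omega> \<in> space M. L \<theta> \<omega> \<in> G}"
      using c0(2) eventually_good eventually_r_gt[OF r, of "ln 2 / (c1 - c0)"] eventually_r_gt[OF r, of "ln 2 / \<delta>"]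
    proof eventually_elim
      case (elim \<theta>)
      then have L\<theta>: "L \<theta> \<in> measurable M weak_borel" "0 < r \<theta>" by auto
      let ?p = "measure M {\<omega> \<in> space M. L \<theta> \<omega> \<in> G}"
      have "exp (r \<theta> * c1) < partition_fn V prob_measures \<theta>"
        using elim(1) L\<theta> by (simp add: scaled_log_mgf_def partition_fn_UNIV[OF L\<theta> V] less_scaled_elog_iff)
      also have "\<dots> \<le> partition_fn V (prob_measures - G') \<theta> + partition_fn V G' \<theta>"
        by (intro partition_fn_subadd L\<theta> V closedin_sets_weak_borel[OF F'] openin_sets_weak_borel[OF G']) auto
      also have "partition_fn V G' \<theta> \<le> exp (r \<theta> * (s + \<delta>)) * measure M {\<omega> \<in> space M. L \<theta> \<omega> \<in> G'}"
        by (rule partition_fn_le_measure[OF L\<theta> V openin_sets_weak_borel[OF G']]) (auto simp: G'_def)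
      also have "measure M {\<omega> \<in> space M. L \<theta> \<omega> \<in> G'} \<le> ?p"
        by (intro finite_measure_mono L_event L\<theta> openin_sets_weak_borel G) (auto simp: G'_def)
      finally have "exp (r \<theta> * c1) < exp (r \<theta> * c0) + exp (r \<theta> * (s + \<delta>)) * ?p"
        using elim(2) by simp
      moreover have "ln 2 + r \<theta> * c0 \<le> r \<theta> * c1" using elim c1 by (simp add: field_simps)
      then have "exp (ln 2 + r \<theta> * c0) \<le> exp (r \<theta> * c1)" by simp
      \<comment> \<open>The term with \<open>c0\<close> is at most half of
        \<open>exp (r \<theta> * c1)\<close>, so the term from \<open>G'\<close> exceeds the other
        half.\<close>
      ultimately have "exp (r \<theta> * c1) < 2 * (exp (r \<theta> * (s + \<delta>)) * ?p)" by (simp add: exp_add)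
      also have "2 \<le> exp (r \<theta> * \<delta>)"
      proof -
        have "ln 2 \<le> r \<theta> * \<delta>" using elim \<delta> by (simp add: field_simps)
        then have "exp (ln 2) \<le> exp (r \<theta> * \<delta>)" by (simp only: exp_le_cancel_iff)
        then show ?thesis by simp
      qed
      also have "exp (r \<theta> * \<delta>) * (exp (r \<theta> * (s + \<delta>)) * ?p) = exp (r \<theta> * (s + 2 * \<delta>)) * ?p"
      proof -
        have "exp (r \<theta> * (s + 2 * \<delta>)) = exp (r \<theta> * \<delta>) * exp (r \<theta> * (s + \<delta>))"
          by (simp add: algebra_simps flip: exp_add)
        then show ?thesis by (simp only: mult.assoc)
      qed
      finally have "exp (r \<theta> * c1) < exp (r \<theta> * (s + 2 * \<delta>)) * ?p"
        by (simp add: mult_right_mono)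
      moreover have "c + (s + 2 * \<delta>) = v - 2 * \<delta>" by (simp add: \<delta>_def field_simps)
      then have "c + (s + 2 * \<delta>) \<le> c1" using c1(3) \<delta> by linarith
      then have "exp (r \<theta> * (c + (s + 2 * \<delta>))) \<le> exp (r \<theta> * c1)" using L\<theta>(2) by simp
      moreover have "exp (r \<theta> * (s + 2 * \<delta>)) * exp (r \<theta> * c) = exp (r \<theta> * (c + (s + 2 * \<delta>)))"
        by (simp only: distrib_left exp_add mult.commute mult.left_commute)
      ultimately have "exp (r \<theta> * (s + 2 * \<delta>)) * exp (r \<theta> * c) < exp (r \<theta> * (s + 2 * \<delta>)) * ?p"
        by linarith
      then show ?case by simp
    qed
  qed
  then show ?thesis by (simp add: Is)
qed

lemma ldp_lower_bound:
  assumes G: "openin weak_topology G"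
  shows "- (INF \<sigma>\<in>G \<inter> unique_equilibrium_states N M L r. I \<sigma>)
    \<le> Liminf N (\<lambda>\<theta>. ereal (1 / r \<theta>) * elog (measure M {\<omega> \<in> space M. L \<theta> \<omega> \<in> G}))" (is "_ \<le> ?l")
proof -
  have "- ?l \<le> (INF \<sigma>\<in>G \<inter> unique_equilibrium_states N M L r. I \<sigma>)"
  proof (rule INF_greatest)
    fix \<sigma> assume \<sigma>: "\<sigma> \<in> G \<inter> unique_equilibrium_states N M L r"
    then obtain V where V: "V \<in> admissible_potentials N M L r" "\<sigma> = (THE \<sigma>. equilibrium_state N M L r V \<sigma>)"
      by (auto simp: unique_equilibrium_states_def)
    then have "equilibrium_state N M L r V \<sigma>"
      using theI'[of "equilibrium_state N M L r V"] by (simp add: admissible_potentials_def)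
    then have "- I \<sigma> \<le> ?l" using \<sigma> G V by (intro ldp_lower_bound_at) auto
    then show "- ?l \<le> I \<sigma>" by (simp add: ereal_uminus_le_reorder)
  qed
  then show ?thesis by (simp add: ereal_uminus_le_reorder)
qed

end

theorem theorem3p2:
  fixes \<Theta> :: "'i set" and prec :: "'i \<Rightarrow> 'i \<Rightarrow> bool"
    and M :: "'w measure"
    and L :: "'i \<Rightarrow> 'w \<Rightarrow> 'a::polish_space measure"
    and r :: "'i \<Rightarrow> real"
  defines "N \<equiv> net_filter \<Theta> prec"
  assumes "directed_set \<Theta> prec"
    and "prob_space M"
    and "\<And>\<theta>. \<theta> \<in> \<Theta> \<Longrightarrow> L \<theta> \<in> measurable M weak_borel"
    and "\<And>\<theta>. \<theta> \<in> \<Theta> \<Longrightarrow> 0 < r \<theta>"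
    and "filterlim r at_top N"
    and AET: "\<And>l::real. 0 < l \<Longrightarrow> \<exists>K. compactin weak_topology K \<and>
           (\<forall>\<epsilon>>0. Limsup N (\<lambda>\<theta>. ereal (1 / r \<theta>) *
                elog (measure M {\<omega> \<in> space M. L \<theta> \<omega> \<in> prob_measures - prob_nhd K \<epsilon>}))
              \<le> ereal (- l))"
  shows "good_rate_function weak_topology (legendre_rate N M L r) \<and>
    (\<forall>F. closedin weak_topology F \<longrightarrow>
       Limsup N (\<lambda>\<theta>. ereal (1 / r \<theta>) * elog (measure M {\<omega> \<in> space M. L \<theta> \<omega> \<in> F}))
         \<le> - (INF \<sigma>\<in>F. legendre_rate N M L r \<sigma>)) \<and>
    (\<forall>G. openin weak_topology G \<longrightarrow>
       - (INF \<sigma>\<in>G \<inter> unique_equilibrium_states N M L r. legendre_rate N M L r \<sigma>)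
         \<le> Liminf N (\<lambda>\<theta>. ereal (1 / r \<theta>) * elog (measure M {\<omega> \<in> space M. L \<theta> \<omega> \<in> G})))"
proof -
  have "exp_tight_net M N L r"
  proof (intro exp_tight_net.intro exp_tight_net_axioms.intro)
    show "\<forall>\<^sub>F \<theta> in N. L \<theta> \<in> measurable M weak_borel"
      unfolding N_def by (rule eventually_mono[OF eventually_in_net[OF assms(2)]]) (rule assms(4))
    show "N \<noteq> bot" unfolding N_def by (rule net_filter_neq_bot[OF assms(2)])
  qed (fact assms)+
  then interpret exp_tight_net M N L r .
  show ?thesis using good_rate_function_legendre ldp_upper_bound ldp_lower_bound by blast
qed

end
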